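(* Let $K$ be a field of characteristic different from $2$. Let $\widetilde S$ be the polynomial ring over $K$ in the variables $x_{i,j},y_{i,j}$ $(1\le i<j\le 4)$, $z_{i,j,k}$ $(1\le i<j<k\le 4)$, $t$, $\tau_1,\dots,\tau_6$, let $J(t)\widetilde S=\langle u_{2,3,4}(t),u_{1,3,4}(t),u_{1,2,4}(t),u_{1,2,3}(t),u(t)\rangle$ and $$I(t)=J(t)\widetilde S+\langle f_1(t),f_2(t)\rangle ,$$ with generators as given in the context. Then the resolution $$\mathcal C(\psi):\ 0\to\widetilde S\to\widetilde S^{7}\to\widetilde S^{12}\to\widetilde S^{7}\to\widetilde S$$ of $\widetilde S/I(t)$, obtained by generic doubling of the resolution of $J(t)$, is not a specialization of the Kustin-Miller family. That is, there is no ring homomorphism from the polynomial ring $R_{KM}$ of the Kustin-Miller model to $\widetilde S$ such that the base change along it of the Kustin-Miller resolution is isomorphic, as a complex, to $\mathcal C(\psi)$.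
   Context: The ideal $J(t)$. Let $\Delta(ij,kl)=x_{i,j}y_{k,l}-x_{k,l}y_{i,j}$, and $\delta_1=\Delta(12,34)$, $\delta_2=\Delta(13,24)$, $\delta_3=\Delta(14,23)$. Put $u_{1,2,3}=-2z_{2,3,4}\Delta(12,13)+2z_{1,3,4}\Delta(12,23)-2z_{1,2,4}\Delta(13,23)+z_{1,2,3}(\delta_2-\delta_1+\delta_3)$, $u_{1,2,4}=2z_{2,3,4}\Delta(12,14)-2z_{1,3,4}\Delta(12,24)+z_{1,2,4}(\delta_1+\delta_2+\delta_3)-2z_{1,2,3}\Delta(14,24)$, $u_{1,3,4}=2z_{2,3,4}\Delta(13,14)+z_{1,3,4}(-\delta_1-\delta_2+\delta_3)+2z_{1,2,4}\Delta(13,34)-2z_{1,2,3}\Delta(14,34)$, $u_{2,3,4}=z_{2,3,4}(-\delta_1+\delta_2-\delta_3)-2z_{1,3,4}\Delta(23,24)+2z_{1,2,4}\Delta(23,34)-2z_{1,2,3}\Delta(24,34)$, and $a=x_{1,2}x_{3,4}-x_{1,3}x_{2,4}+x_{1,4}x_{2,3}$, $b=x_{1,2}y_{3,4}-x_{1,3}y_{2,4}+x_{1,4}y_{2,3}+x_{3,4}y_{1,2}-x_{2,4}y_{1,3}+x_{2,3}y_{1,4}$, $c=y_{1,2}y_{3,4}-y_{1,3}y_{2,4}+y_{1,4}y_{2,3}$, $\ u=b^2-4ac$. Set $u_{1,2,3}(t)=-u_{1,2,3}-z_{1,2,3}t$, $u_{1,2,4}(t)=-u_{1,2,4}+z_{1,2,4}t$,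 $u_{1,3,4}(t)=-u_{1,3,4}+z_{1,3,4}t$, $u_{2,3,4}(t)=-u_{2,3,4}+z_{2,3,4}t$, $u(t)=u-t^2$. Let $S=K[x_{i,j},y_{i,j},z_{i,j,k},t]$ and let $J(t)\subset S$ be the ideal generated by these five elements. It is known that $J(t)$ is perfect of codimension $3$ with minimal free resolution $\mathbb F$ of format $0\to S^2\xrightarrow{d_3(t)}S^6\to S^5\to S$. With the conventions $x_{j,i}=-x_{i,j}$, $y_{j,i}=-y_{i,j}$, and $z_{\hat i}=z_{j,k,l}$ for $\{j<k<l\}=\{1,2,3,4\}\setminus\{i\}$, put $u_j=\sum_{i\ne j}(-1)^ix_{i,j}z_{\hat i}$ and $v_j=\sum_{i\neq j}(-1)^iy_{i,j}z_{\hat i}$ for $1\le j\le 4$. The $6\times 2$ matrix $d_3(t)$ has rows $(b+t,\,2a)$, $(-2c,\,-b+t)$, $(-v_1,-u_1)$, $(v_2,u_2)$, $(v_3,u_3)$, $(-v_4,-u_4)$. The ideal $I(t)$. In $\widetilde S=S[\tau_1,\dots,\tau_6]$ put $f_1(t)=-\tau_1u_4-\tau_2u_3-\tau_3u_2-\tau_4u_1+\tau_5b+2a\tau_6-\tau_5t$, $f_2(t)=\tau_1v_4+\tau_2v_3+\tau_3v_2+\tau_4v_1-2c\tau_5-b\tau_6-\tau_6t$. The row $\psi_1(t)=[f_1(t)\ f_2(t)]$ induces an injective map $\omega_{\widetilde S/J(t)\widetilde S}=\operatorname{coker}(d_3(t)^T)\to\widetilde S/J(t)\widetilde S$; it lifts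 to a chain map $\psi:\widetilde{\mathbb F}^*\to\widetilde{\mathbb F}$, where $\widetilde{\mathbb F}=\mathbb F\otimes_S\widetilde S$, and $\mathcal C(\psi)$ is the mapping cone of $\psi$. It is a minimal free resolution of the Gorenstein codimension $4$ quotient $\widetilde S/I(t)$. The Kustin-Miller model (KMM). Let $R_{KM}=K[x_1,\dots,x_4,\,a_{ij}\ (1\le i\le3,1\le j\le4),\,v]$, let $M=(a_{ij})$ be the $3\times4$ matrix, $q_i=\sum_{j=1}^4a_{ij}x_j$, and write $M_{123;jkl}$ for the maximal minor of $M$ on columns $j,k,l$. The Kustin-Miller ideal is $$I_{KM}=\langle q_1,q_2,q_3,\ x_1v+M_{123;234},\ x_2v-M_{123;134},\ x_3v+M_{123;124},\ x_4v-M_{123;123}\rangle ,$$ a Gorenstein ideal of codimension $4$. The Kustin-Miller resolution is its minimal free resolution $0\to R_{KM}\to R_{KM}^7\to R_{KM}^{12}\to R_{KM}^7\to R_{KM}$. A specialization of it is a resolution isomorphic to its base change along a ring homomorphism out of $R_{KM}$. *)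

theory Defs
  imports
    "HOL-Library.Poly_Mapping"
    "Jordan_Normal_Form.Determinant"
    "Jordan_Normal_Form.Matrix_Kernel"
begin

section \<open>Polynomial rings and ideals\<close>

type_synonym ('v, 'a) mpoly = "('v \<Rightarrow>\<^sub>0 nat) \<Rightarrow>\<^sub>0 'a"

definition Var :: "'v \<Rightarrow> ('v, 'a::comm_ring_1) mpoly" where
  "Var v = Poly_Mapping.single (Poly_Mapping.single v 1) 1"

definition Const :: "'a::comm_ring_1 \<Rightarrow> ('v, 'a) mpoly" where
  "Const = Poly_Mapping.single 0"

definition ideal_gen :: "'a::comm_ring_1 set \<Rightarrow> 'a set" where
  "ideal_gen B = Modules.module.span (*) B"

section \<open>Complexes of finitely generated free modules\<close>

text \<open>
  A complex of finitely generated free modules \<open>\<dots> \<rightarrow> C\<^sub>2 \<rightarrow> C\<^sub>1 \<rightarrow> C\<^sub>0\<close> with chosen bases is the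
  sequence of its differentials, where \<open>C n\<close> is the matrix (acting on column vectors) of
  \<open>C\<^sub>n\<^sub>+\<^sub>1 \<rightarrow> C\<^sub>n\<close>.  A bounded complex continues with matrices without columns.
\<close>

definition rank :: "(nat \<Rightarrow> 'a mat) \<Rightarrow> nat \<Rightarrow> nat" where
  "rank C n = dim_row (C n)"

definition free_complex :: "(nat \<Rightarrow> 'a::comm_ring_1 mat) \<Rightarrow> bool" where
  "free_complex C \<longleftrightarrow>
     (\<forall>n. C n \<in> carrier_mat (rank C n) (rank C (Suc n)) \<and>
          C n * C (Suc n) = 0\<^sub>m (rank C n) (rank C (Suc (Suc n))))"

definition mat_image :: "'a::comm_ring_1 mat \<Rightarrow> 'a vec set" where
  "mat_image A = (\<lambda>w. A *\<^sub>v w) ` carrier_vec (dim_col A)"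

text \<open>
  The list \<open>rs\<close> contains the ranks in homological degrees \<open>0, \<dots>, length rs - 1\<close>; all further
  ranks are \<open>0\<close>.  For \<open>rs = [1, r\<^sub>1, \<dots>]\<close>, the last clause says that the cokernel of the
  first differential is \<open>R/I\<close>.
\<close>

definition free_resolution ::
    "nat list \<Rightarrow> 'a::comm_ring_1 set \<Rightarrow> (nat \<Rightarrow> 'a mat) \<Rightarrow> bool" where
  "free_resolution rs I C \<longleftrightarrow>
     free_complex C \<and>
     (\<forall>n. rank C n = (if n < length rs then rs ! n else 0)) \<and>
     (\<forall>n. mat_kernel (C n) = mat_image (C (Suc n))) \<and>
     rank C 0 = 1 \<and> (\<lambda>w. w $ 0) ` mat_image (C 0) = I"

definition minimal_free_resolution ::
    "nat list \<Rightarrow> ('v, 'k::field) mpoly set \<Rightarrow> (nat \<Rightarrow> ('v, 'k) mpoly mat) \<Rightarrow> bool" where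
  "minimal_free_resolution rs I C \<longleftrightarrow>
     free_resolution rs I C \<and> (\<forall>n. elements_mat (C n) \<subseteq> ideal_gen (range Var))"

definition base_change :: "('a \<Rightarrow> 'b) \<Rightarrow> (nat \<Rightarrow> 'a mat) \<Rightarrow> nat \<Rightarrow> 'b mat" where
  "base_change \<phi> C n = map_mat \<phi> (C n)"

definition chain_map ::
    "(nat \<Rightarrow> 'a::comm_ring_1 mat) \<Rightarrow> (nat \<Rightarrow> 'a mat) \<Rightarrow> (nat \<Rightarrow> 'a mat) \<Rightarrow> bool" where
  "chain_map A B \<psi> \<longleftrightarrow>
     (\<forall>n. \<psi> n \<in> carrier_mat (rank B n) (rank A n) \<and> \<psi> n * A n = B n * \<psi> (Suc n))"

definition complex_iso ::
    "(nat \<Rightarrow> 'a::comm_ring_1 mat) \<Rightarrow> (nat \<Rightarrow> 'a mat) \<Rightarrow> bool" where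
  "complex_iso C D \<longleftrightarrow> (\<exists>U. chain_map C D U \<and> (\<forall>n. invertible_mat (U n)))"

text \<open>
  The dual of a complex \<open>0 \<rightarrow> C\<^sub>l \<rightarrow> \<dots> \<rightarrow> C\<^sub>0\<close>, reindexed so that \<open>C\<^sub>l\<^sup>*\<close> is in degree \<open>0\<close> and
  \<open>C\<^sub>0\<^sup>*\<close> in degree \<open>l\<close>.
\<close>

definition dual_complex :: "nat \<Rightarrow> (nat \<Rightarrow> 'a::comm_ring_1 mat) \<Rightarrow> nat \<Rightarrow> 'a mat" where
  "dual_complex l C n =
     (if n < l then transpose_mat (C (l - 1 - n))
      else if n = l then 0\<^sub>m (rank C 0) 0 else 0\<^sub>m 0 0)"

text \<open>
  In degree \<open>n\<close> the mapping cone of \<open>\<psi> : A \<rightarrow> B\<close> is \<open>A\<^sub>n\<^sub>-\<^sub>1 \<oplus> B\<^sub>n\<close> (with \<open>A\<^sub>-\<^sub>1 = 0\<close>), and its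
  differential is \<open>(a, b) \<mapsto> (- d a, \<psi> a + d b)\<close>.
\<close>

fun mapping_cone ::
    "(nat \<Rightarrow> 'a::comm_ring_1 mat) \<Rightarrow> (nat \<Rightarrow> 'a mat) \<Rightarrow> (nat \<Rightarrow> 'a mat) \<Rightarrow> nat \<Rightarrow> 'a mat" where
  "mapping_cone A B \<psi> 0 =
     four_block_mat (0\<^sub>m 0 (rank A 0)) (0\<^sub>m 0 (rank B 1)) (\<psi> 0) (B 0)"
| "mapping_cone A B \<psi> (Suc n) =
     four_block_mat (- A n) (0\<^sub>m (rank A n) (rank B (Suc (Suc n)))) (\<psi> (Suc n)) (B (Suc n))"

definition is_specialization ::
    "(nat \<Rightarrow> 'a::comm_ring_1 mat) \<Rightarrow> (nat \<Rightarrow> 'b::comm_ring_1 mat) \<Rightarrow> bool" where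
  "is_specialization G C \<longleftrightarrow>
     (\<exists>\<phi> :: 'a \<Rightarrow> 'b. comm_ring_hom \<phi> \<and> complex_iso (base_change \<phi> G) C)"

section \<open>The ideal \<open>J(t)\<close>\<close>

datatype pair4 = P12 | P13 | P14 | P23 | P24 | P34

datatype triple4 = P123 | P124 | P134 | P234

datatype svar = VX pair4 | VY pair4 | VZ triple4 | VT

text \<open>\<open>'k S\<close> is the polynomial ring in the \<open>17\<close> variables \<open>x\<^sub>i\<^sub>,\<^sub>j, y\<^sub>i\<^sub>,\<^sub>j, z\<^sub>i\<^sub>,\<^sub>j\<^sub>,\<^sub>k, t\<close>.\<close>

type_synonym 'k S = "(svar, 'k) mpoly"

text \<open>The pair \<open>{i, j}\<close> for \<open>1 \<le> i < j \<le> 4\<close>; other arguments are not used.\<close>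

definition pair4_of :: "nat \<Rightarrow> nat \<Rightarrow> pair4" where
  "pair4_of i j =
     (if (i, j) = (1, 2) then P12 else if (i, j) = (1, 3) then P13
      else if (i, j) = (1, 4) then P14 else if (i, j) = (2, 3) then P23
      else if (i, j) = (2, 4) then P24 else P34)"

definition skew :: "(pair4 \<Rightarrow> 'a::comm_ring_1) \<Rightarrow> nat \<Rightarrow> nat \<Rightarrow> 'a" where
  "skew g i j = (if i < j then g (pair4_of i j) else if j < i then - g (pair4_of j i) else 0)"

definition xc :: "nat \<Rightarrow> nat \<Rightarrow> 'k::field S" where "xc = skew (\<lambda>p. Var (VX p))"

definition yc :: "nat \<Rightarrow> nat \<Rightarrow> 'k::field S" where "yc = skew (\<lambda>p. Var (VY p))"

definition z123 :: "'k::field S" where "z123 = Var (VZ P123)"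
definition z124 :: "'k::field S" where "z124 = Var (VZ P124)"
definition z134 :: "'k::field S" where "z134 = Var (VZ P134)"
definition z234 :: "'k::field S" where "z234 = Var (VZ P234)"

definition tc :: "'k::field S" where "tc = Var VT"

text \<open>\<open>\<Delta> i j k l\<close> is the minor written \<open>\<Delta>(ij,kl)\<close>.\<close>

definition \<Delta> :: "nat \<Rightarrow> nat \<Rightarrow> nat \<Rightarrow> nat \<Rightarrow> 'k::field S" where
  "\<Delta> i j k l = xc i j * yc k l - xc k l * yc i j"

definition \<delta>1 :: "'k::field S" where "\<delta>1 = \<Delta> 1 2 3 4"
definition \<delta>2 :: "'k::field S" where "\<delta>2 = \<Delta> 1 3 2 4"
definition \<delta>3 :: "'k::field S" where "\<delta>3 = \<Delta> 1 4 2 3"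

definition u123 :: "'k::field S" where
  "u123 = - 2 * z234 * \<Delta> 1 2 1 3 + 2 * z134 * \<Delta> 1 2 2 3 - 2 * z124 * \<Delta> 1 3 2 3
          + z123 * (\<delta>2 - \<delta>1 + \<delta>3)"

definition u124 :: "'k::field S" where
  "u124 = 2 * z234 * \<Delta> 1 2 1 4 - 2 * z134 * \<Delta> 1 2 2 4 + z124 * (\<delta>1 + \<delta>2 + \<delta>3)
          - 2 * z123 * \<Delta> 1 4 2 4"

definition u134 :: "'k::field S" where
  "u134 = 2 * z234 * \<Delta> 1 3 1 4 + z134 * (- \<delta>1 - \<delta>2 + \<delta>3) + 2 * z124 * \<Delta> 1 3 3 4
          - 2 * z123 * \<Delta> 1 4 3 4"

definition u234 :: "'k::field S" where
  "u234 = z234 * (- \<delta>1 + \<delta>2 - \<delta>3) - 2 * z134 * \<Delta> 2 3 2 4 + 2 * z124 * \<Delta> 2 3 3 4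
          - 2 * z123 * \<Delta> 2 4 3 4"

definition pa :: "'k::field S" where
  "pa = xc 1 2 * xc 3 4 - xc 1 3 * xc 2 4 + xc 1 4 * xc 2 3"

definition pb :: "'k::field S" where
  "pb = xc 1 2 * yc 3 4 - xc 1 3 * yc 2 4 + xc 1 4 * yc 2 3
       + xc 3 4 * yc 1 2 - xc 2 4 * yc 1 3 + xc 2 3 * yc 1 4"

definition pc :: "'k::field S" where
  "pc = yc 1 2 * yc 3 4 - yc 1 3 * yc 2 4 + yc 1 4 * yc 2 3"

definition u0 :: "'k::field S" where "u0 = pb\<^sup>2 - 4 * pa * pc"

definition J_gens :: "'k::field S set" where
  "J_gens = {- u234 + z234 * tc, - u134 + z134 * tc, - u124 + z124 * tc, - u123 - z123 * tc,
             u0 - tc\<^sup>2}"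

definition zhat :: "nat \<Rightarrow> 'k::field S" where
  "zhat i = (if i = 1 then z234 else if i = 2 then z134 else if i = 3 then z124 else z123)"

definition uc :: "nat \<Rightarrow> 'k::field S" where
  "uc j = (\<Sum>i\<in>{1..4} - {j}. (- 1) ^ i * xc i j * zhat i)"

definition vc :: "nat \<Rightarrow> 'k::field S" where
  "vc j = (\<Sum>i\<in>{1..4} - {j}. (- 1) ^ i * yc i j * zhat i)"

definition d3 :: "'k::field S mat" where
  "d3 = mat_of_rows_list 2
     [[pb + tc, 2 * pa],
      [- 2 * pc, - pb + tc],
      [- vc 1, - uc 1],
      [vc 2, uc 2],
      [vc 3, uc 3],
      [- vc 4, - uc 4]]"

section \<open>Generic doubling\<close>

datatype tauvar = T1 | T2 | T3 | T4 | T5 | T6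

text \<open>
  \<open>S[\<tau>\<^sub>1, \<dots>, \<tau>\<^sub>6]\<close>, that is, the polynomial ring over \<open>'k\<close> in \<open>23\<close> variables, with \<open>Const\<close> as the
  inclusion of \<open>S\<close>.
\<close>

type_synonym 'k S_ext = "(tauvar, 'k S) mpoly"

definition f1 :: "'k::field S_ext" where
  "f1 = - Var T1 * Const (uc 4) - Var T2 * Const (uc 3) - Var T3 * Const (uc 2)
        - Var T4 * Const (uc 1) + Var T5 * Const pb + 2 * Const pa * Var T6 - Var T5 * Const tc"

definition f2 :: "'k::field S_ext" where
  "f2 = Var T1 * Const (vc 4) + Var T2 * Const (vc 3) + Var T3 * Const (vc 2)
        + Var T4 * Const (vc 1) - 2 * Const pc * Var T5 - Const pb * Var T6 - Var T6 * Const tc"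

definition I_t :: "'k::field S_ext set" where
  "I_t = ideal_gen (Const ` J_gens \<union> {f1, f2})"

text \<open>The complex over \<open>S[\<tau>]\<close> extended from a complex over \<open>S\<close>.\<close>

definition extend_S :: "(nat \<Rightarrow> 'k::field S mat) \<Rightarrow> nat \<Rightarrow> 'k S_ext mat" where
  "extend_S F = base_change Const F"

text \<open>
  \<open>\<psi>\<close> is a lift, from the dual of the extension of \<open>F\<close> to the extension of \<open>F\<close>, of the map given
  by the row \<open>[f1 f2]\<close>.
\<close>

definition doubling_lift :: "(nat \<Rightarrow> 'k::field S mat) \<Rightarrow> (nat \<Rightarrow> 'k S_ext mat) \<Rightarrow> bool" where
  "doubling_lift F \<psi> \<longleftrightarrow>
     chain_map (dual_complex 3 (extend_S F)) (extend_S F) \<psi> \<and>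
     \<psi> 0 = mat_of_rows_list 2 [[f1, f2]]"

definition doubling :: "(nat \<Rightarrow> 'k::field S mat) \<Rightarrow> (nat \<Rightarrow> 'k S_ext mat) \<Rightarrow> nat \<Rightarrow> 'k S_ext mat" where
  "doubling F \<psi> = mapping_cone (dual_complex 3 (extend_S F)) (extend_S F) \<psi>"

section \<open>The Kustin-Miller model\<close>

datatype row3 = R1 | R2 | R3

datatype col4 = C1 | C2 | C3 | C4

datatype kmvar = KX col4 | KA row3 col4 | KV

type_synonym 'k R_KM = "(kmvar, 'k) mpoly"

definition qc :: "row3 \<Rightarrow> 'k::field R_KM" where
  "qc i = (\<Sum>j\<in>{C1, C2, C3, C4}. Var (KA i j) * Var (KX j))"

definition minor :: "col4 \<Rightarrow> col4 \<Rightarrow> col4 \<Rightarrow> 'k::field R_KM" where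
  "minor j k l = det (mat_of_rows_list 3
     (map (\<lambda>i. [Var (KA i j), Var (KA i k), Var (KA i l)]) [R1, R2, R3]))"

definition I_KM :: "'k::field R_KM set" where
  "I_KM = ideal_gen
     {qc R1, qc R2, qc R3,
      Var (KX C1) * Var KV + minor C2 C3 C4,
      Var (KX C2) * Var KV - minor C1 C3 C4,
      Var (KX C3) * Var KV + minor C1 C2 C4,
      Var (KX C4) * Var KV - minor C1 C2 C3}"

section \<open>The zeroth homology of the doubling\<close>

text \<open>The qualifier is needed because \<open>HOL-Algebra\<close> has a locale of the same name.\<close>

lemma module_times: "Modules.module ((*) :: 'a::comm_ring_1 \<Rightarrow> 'a \<Rightarrow> 'a)"
  by unfold_locales (auto simp: algebra_simps)

lemma ideal_gen_minimal:
  assumes "B \<subseteq> I" "0 \<in> I" "\<And>a b. a \<in> I \<Longrightarrow> b \<in> I \<Longrightarrow> a + b \<in> I" "\<And>r a. a \<in> I \<Longrightarrow> r * a \<in> I"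
  shows "ideal_gen B \<subseteq> (I :: 'a::comm_ring_1 set)"
  unfolding ideal_gen_def
  by (rule Modules.module.span_minimal[OF module_times])
    (use assms in \<open>auto simp: Modules.module.subspace_def[OF module_times]\<close>)

lemmas ideal_gen_base = Modules.module.span_base[OF module_times, folded ideal_gen_def]
  and ideal_gen_0 = Modules.module.span_zero[OF module_times, folded ideal_gen_def]
  and ideal_gen_add = Modules.module.span_add[OF module_times, folded ideal_gen_def]
  and ideal_gen_mult = Modules.module.span_scale[OF module_times, folded ideal_gen_def]
  and ideal_gen_sum = Modules.module.span_sum[OF module_times, folded ideal_gen_def]
  and ideal_gen_mono = Modules.module.span_mono[OF module_times, folded ideal_gen_def]

lemma ideal_gen_subsetI: "B \<subseteq> ideal_gen C \<Longrightarrow> ideal_gen B \<subseteq> ideal_gen C"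
  by (rule ideal_gen_minimal) (auto intro: ideal_gen_0 ideal_gen_add ideal_gen_mult)

lemma ideal_gen_hom:
  assumes "comm_ring_hom h"
  shows "h ` ideal_gen B \<subseteq> ideal_gen (h ` B)"
proof -
  interpret comm_ring_hom h by fact
  have "ideal_gen B \<subseteq> {p. h p \<in> ideal_gen (h ` B)}"
    by (rule ideal_gen_minimal)
      (auto simp: hom_add hom_mult intro: ideal_gen_base ideal_gen_0 ideal_gen_add ideal_gen_mult)
  then show ?thesis by blast
qed

lemma elements_mat_row:
  assumes "M \<in> carrier_mat 1 n"
  shows "elements_mat M = (\<lambda>j. M $$ (0, j)) ` {..<n}"
proof
  show "elements_mat M \<subseteq> (\<lambda>j. M $$ (0, j)) ` {..<n}"
    using assms by (force dest!: elements_matD)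
  show "(\<lambda>j. M $$ (0, j)) ` {..<n} \<subseteq> elements_mat M"
    using assms by (auto intro: elements_matI)
qed

lemma row_image_eq_ideal_gen:
  assumes A: "A \<in> carrier_mat 1 n"
  shows "(\<lambda>w. w $ 0) ` mat_image A = ideal_gen (elements_mat A)" (is "?L = _")
proof
  have entry: "A $$ (0, j) \<in> elements_mat A" if "j < n" for j
    using A that by (auto intro: elements_matI)
  show "?L \<subseteq> ideal_gen (elements_mat A)"
  proof
    fix p assume "p \<in> ?L"
    then obtain w where w: "w \<in> carrier_vec n" "p = (A *\<^sub>v w) $ 0"
      using A by (auto simp: mat_image_def)
    have "p = (\<Sum>j = 0..<n. w $ j * A $$ (0, j))"
      using A w by (simp add: scalar_prod_def mult.commute)
    also have "\<dots> \<in> ideal_gen (elements_mat A)"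
      by (intro ideal_gen_sum ideal_gen_mult ideal_gen_base entry) auto
    finally show "p \<in> ideal_gen (elements_mat A)" .
  qed
  show "ideal_gen (elements_mat A) \<subseteq> ?L"
  proof (rule ideal_gen_minimal)
    show "elements_mat A \<subseteq> ?L"
    proof
      fix p assume "p \<in> elements_mat A"
      then obtain j where j: "j < n" "p = A $$ (0, j)"
        using A by auto
      then have "p = (A *\<^sub>v unit_vec n j) $ 0" "unit_vec n j \<in> carrier_vec (dim_col A)"
        using A by auto
      then show "p \<in> ?L"
        unfolding mat_image_def image_image by (rule image_eqI)
    qed
    have "(A *\<^sub>v 0\<^sub>v n) $ 0 = 0" "0\<^sub>v n \<in> carrier_vec (dim_col A)"
      using A by auto
    then show "0 \<in> ?L"
      unfolding mat_image_def image_image by (intro image_eqI[of _ _ "0\<^sub>v n"]) simp_all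
  next
    fix p p' assume "p \<in> ?L" "p' \<in> ?L"
    then obtain w w' where "w \<in> carrier_vec n" "p = (A *\<^sub>v w) $ 0"
      "w' \<in> carrier_vec n" "p' = (A *\<^sub>v w') $ 0"
      using A by (auto simp: mat_image_def)
    then have "p + p' = (A *\<^sub>v (w + w')) $ 0" "w + w' \<in> carrier_vec (dim_col A)"
      using A by (auto simp: mult_add_distrib_mat_vec)
    then show "p + p' \<in> ?L"
      by (auto simp: mat_image_def)
  next
    fix r p assume "p \<in> ?L"
    then obtain w where "w \<in> carrier_vec n" "p = (A *\<^sub>v w) $ 0"
      using A by (auto simp: mat_image_def)
    then have "r * p = (A *\<^sub>v (r \<cdot>\<^sub>v w)) $ 0" "r \<cdot>\<^sub>v w \<in> carrier_vec (dim_col A)"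
      using A by (auto simp: mult_mat_vec)
    then show "r * p \<in> ?L"
      by (auto simp: mat_image_def)
  qed
qed

lemma comm_ring_hom_Const: "comm_ring_hom (Const :: 'a::comm_ring_1 \<Rightarrow> ('v, 'a) mpoly)"
  by unfold_locales (simp_all add: Const_def single_add mult_single)

text \<open>The zeroth homology of the doubling is \<open>S[\<tau>]/I(t)\<close>.\<close>

lemma doubling_H0:
  fixes F :: "nat \<Rightarrow> 'k::field S mat"
  assumes F: "minimal_free_resolution [1, 5, 6, 2] (ideal_gen J_gens) F"
    and \<psi>: "doubling_lift F \<psi>"
  shows "(\<lambda>w. w $ 0) ` mat_image (doubling F \<psi> 0) = I_t"
proof -
  have rank: "rank F n = (if n < length [1::nat, 5, 6, 2] then [1, 5, 6, 2] ! n else 0)"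
    and carrier: "F n \<in> carrier_mat (rank F n) (rank F (Suc n))" for n
    using F unfolding minimal_free_resolution_def free_resolution_def free_complex_def by blast+
  have F0: "F 0 \<in> carrier_mat 1 5" and F1: "F 1 \<in> carrier_mat 5 6" and F2: "F 2 \<in> carrier_mat 6 2"
    using carrier[of 0] carrier[of 1] carrier[of 2] rank by (simp_all add: numeral_eq_Suc)
  have J: "ideal_gen (elements_mat (F 0)) = ideal_gen J_gens"
    using F row_image_eq_ideal_gen[OF F0]
    by (simp add: minimal_free_resolution_def free_resolution_def)
  define A where "A = doubling F \<psi> 0"
  have \<psi>0: "\<psi> 0 = mat_of_rows_list 2 [[f1, f2]]"
    using \<psi> by (simp add: doubling_lift_def)
  have A_eq: "A = four_block_mat (0\<^sub>m 0 2) (0\<^sub>m 0 5) (mat_of_rows_list 2 [[f1, f2]])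
                    (map_mat Const (F 0))"
    using F0 F1 F2 \<psi>0
    by (simp add: A_def doubling_def rank_def dual_complex_def extend_S_def base_change_def)
  have A: "A \<in> carrier_mat 1 7"
    using F0 by (intro carrier_matI) (auto simp: A_eq mat_of_rows_list_def)
  have A_entries: "A $$ (0, 0) = f1" "A $$ (0, 1) = f2"
    "\<And>j. j < 5 \<Longrightarrow> A $$ (0, j + 2) = Const (F 0 $$ (0, j))"
    using F0 by (auto simp: A_eq mat_of_rows_list_def)
  have seven: "{..<7} = {0, 1} \<union> (\<lambda>j. j + 2) ` {..<5::nat}"
    by (auto simp: eval_nat_numeral lessThan_Suc)
  have "elements_mat A = {f1, f2} \<union> (\<lambda>j. A $$ (0, j + 2)) ` {..<5}"
    unfolding elements_mat_row[OF A] seven image_Un image_image using A_entries by simp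
  also have "(\<lambda>j. A $$ (0, j + 2)) ` {..<5} = (\<lambda>j. Const (F 0 $$ (0, j))) ` {..<5}"
    by (intro image_cong) (simp_all only: A_entries lessThan_iff)
  also have "\<dots> = Const ` elements_mat (F 0)"
    unfolding elements_mat_row[OF F0] image_image ..
  finally have elems: "elements_mat A = {f1, f2} \<union> Const ` elements_mat (F 0)" .
  have "Const ` elements_mat (F 0) \<subseteq> ideal_gen (Const ` J_gens)"
    using ideal_gen_hom[OF comm_ring_hom_Const, of J_gens] J ideal_gen_base by blast
  moreover have "Const ` J_gens \<subseteq> ideal_gen (Const ` elements_mat (F 0))"
    using ideal_gen_hom[OF comm_ring_hom_Const, of "elements_mat (F 0)"] J ideal_gen_base by blast
  moreover have "ideal_gen (Const ` J_gens) \<subseteq> I_t"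
    unfolding I_t_def by (rule ideal_gen_mono) auto
  moreover have "ideal_gen (Const ` elements_mat (F 0)) \<subseteq> ideal_gen (elements_mat A)"
    unfolding elems by (rule ideal_gen_mono) auto
  moreover have "{f1, f2} \<subseteq> I_t" "{f1, f2} \<subseteq> ideal_gen (elements_mat A)"
    unfolding I_t_def elems by (auto intro!: ideal_gen_base)
  ultimately have "ideal_gen (elements_mat A) = I_t"
    unfolding I_t_def
    by (intro equalityI ideal_gen_subsetI) (auto simp: elems)
  then show ?thesis
    using row_image_eq_ideal_gen[OF A] by (simp add: A_def)
qed

end

theory Submission
  imports Defs
begin

text \<open>
  The zeroth homology alone already distinguishes the two complexes: \<open>I(t)\<close> is not generated by
  the seven Kustin-Miller elements \<open>q\<^sub>i\<close>, \<open>p\<^sub>j = x\<^sub>j v \<plusminus> M\<^sub>j\<close> for any choice of \<open>x\<close>, \<open>a\<close>, \<open>v\<close> in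
  \<open>S[\<tau>]\<close>.  The quadratic parts of the generators of \<open>I(t)\<close> are \<open>t\<close> times seven independent linear
  forms \<open>w\<^sub>i\<close>, so seven Kustin-Miller generators have independent quadratic parts as well, and their
  first syzygies show that \<open>x\<close>, \<open>a\<close>, \<open>v\<close> have no constant terms.  Then the quadratic part
  of \<open>p\<^sub>j\<close> is that of \<open>x\<^sub>j v\<close>, which forces the linear part of \<open>v\<close> to be a multiple of \<open>t\<close> and the
  linear part of \<open>x\<^sub>j\<close> to be, modulo \<open>t\<close>, proportional to \<open>\<Sum>\<^sub>i d\<^sub>j\<^sub>i w\<^sub>i\<close>, where
  \<open>d\<close> is the invertible constant part of the base change between the generators.

  Modulo \<open>t\<close> the ideal starts in degree \<open>3\<close>, with cubic parts \<open>n\<^sub>i\<close>, so the degree \<open>4\<close> part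
  of \<open>x\<^sub>k p\<^sub>j - x\<^sub>j p\<^sub>k \<in> (2 \<times> 2 minors of a) \<cdot> (q\<^sub>1, q\<^sub>2, q\<^sub>3)\<close> is
  \<open>(\<Sum>\<^sub>i d\<^sub>k\<^sub>i w\<^sub>i) (\<Sum>\<^sub>i d\<^sub>j\<^sub>i n\<^sub>i) = (\<Sum>\<^sub>i d\<^sub>j\<^sub>i w\<^sub>i) (\<Sum>\<^sub>i d\<^sub>k\<^sub>i n\<^sub>i)\<close>.
  When \<open>2 \<noteq> 0\<close> the products \<open>w\<^sub>i n\<^sub>i\<^sub>' - w\<^sub>i\<^sub>' n\<^sub>i\<close> are linearly independent, so three rows of \<open>d\<close>
  have rank at most \<open>1\<close> outside a single column, which contradicts invertibility.
\<close>

text \<open>Coefficients are attached to indices instead of elements, so that two generating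
  families are related by honest matrices even when generators coincide.\<close>

lemma ideal_gen_imageD:
  fixes h :: "nat \<Rightarrow> 'a::comm_ring_1"
  assumes "p \<in> ideal_gen (h ` {..<n})"
  shows "\<exists>c. p = (\<Sum>i<n. c i * h i)"
proof -
  have "ideal_gen (h ` {..<n}) \<subseteq> {p. \<exists>c. p = (\<Sum>i<n. c i * h i)}"
  proof (rule ideal_gen_minimal)
    show "h ` {..<n} \<subseteq> {p. \<exists>c. p = (\<Sum>i<n. c i * h i)}"
    proof clarify
      fix j assume "j < n"
      then have "h j = (\<Sum>i<n. (if i = j then 1 else 0) * h i)"
        by (simp add: if_distrib[of "\<lambda>x. x * _"] sum.delta cong: if_cong)
      then show "\<exists>c. h j = (\<Sum>i<n. c i * h i)"
        by (rule exI[of _ "\<lambda>i. if i = j then 1 else 0"])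
    qed
    show "0 \<in> {p. \<exists>c. p = (\<Sum>i<n. c i * h i)}"
      by (auto intro!: exI[of _ "\<lambda>_. 0"])
  next
    fix a b assume "a \<in> {p. \<exists>c. p = (\<Sum>i<n. c i * h i)}" "b \<in> {p. \<exists>c. p = (\<Sum>i<n. c i * h i)}"
    then obtain c d where "a = (\<Sum>i<n. c i * h i)" "b = (\<Sum>i<n. d i * h i)" by auto
    then have "a + b = (\<Sum>i<n. (c i + d i) * h i)" by (simp add: sum.distrib distrib_right)
    then show "a + b \<in> {p. \<exists>c. p = (\<Sum>i<n. c i * h i)}"
      by (intro CollectI exI[of _ "\<lambda>i. c i + d i"])
  next
    fix r a assume "a \<in> {p. \<exists>c. p = (\<Sum>i<n. c i * h i)}"
    then obtain c where "a = (\<Sum>i<n. c i * h i)" by auto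
    then have "r * a = (\<Sum>i<n. (r * c i) * h i)" by (simp add: sum_distrib_left mult.assoc)
    then show "r * a \<in> {p. \<exists>c. p = (\<Sum>i<n. c i * h i)}"
      by (intro CollectI exI[of _ "\<lambda>i. r * c i"])
  qed
  then show ?thesis using assms by blast
qed

section \<open>Evaluation of polynomials\<close>

lemma sum_single_lookup:
  "(\<Sum>m\<in>Poly_Mapping.keys p. Poly_Mapping.single m (Poly_Mapping.lookup p m)) = (p :: 'a \<Rightarrow>\<^sub>0 'b::comm_monoid_add)"
  by (rule poly_mapping_eqI)
    (auto simp: lookup_sum lookup_single when_def sum.delta in_keys_iff)

definition monom_value :: "('v \<Rightarrow> 'b::comm_ring_1) \<Rightarrow> ('v \<Rightarrow>\<^sub>0 nat) \<Rightarrow> 'b" where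
  "monom_value g m = (\<Prod>v\<in>Poly_Mapping.keys m. g v ^ Poly_Mapping.lookup m v)"

lemma monom_value_superset:
  "finite V \<Longrightarrow> Poly_Mapping.keys m \<subseteq> V \<Longrightarrow> monom_value g m = (\<Prod>v\<in>V. g v ^ Poly_Mapping.lookup m v)"
  unfolding monom_value_def by (rule prod.mono_neutral_left) (auto simp: in_keys_iff)

lemma monom_value_0 [simp]: "monom_value g 0 = 1"
  by (simp add: monom_value_def)

lemma monom_value_single [simp]: "monom_value g (Poly_Mapping.single v n) = g v ^ n"
  by (cases "n = 0") (simp_all add: monom_value_def)

lemma monom_value_add: "monom_value g (m + m') = monom_value g m * monom_value g m'"
proof -
  let ?V = "Poly_Mapping.keys m \<union> Poly_Mapping.keys m'"
  have "Poly_Mapping.keys (m + m') \<subseteq> ?V" by (rule Poly_Mapping.keys_add)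
  then show ?thesis
    by (simp add: monom_value_superset[of ?V] lookup_add power_add prod.distrib)
qed

text \<open>The map \<open>f\<close> on coefficients is a parameter because \<open>S_ext\<close> is
  a polynomial ring over a polynomial ring, so evaluation is applied twice.\<close>

definition mpoly_eval ::
    "('a::comm_ring_1 \<Rightarrow> 'b::comm_ring_1) \<Rightarrow> ('v \<Rightarrow> 'b) \<Rightarrow> ('v, 'a) mpoly \<Rightarrow> 'b" where
  "mpoly_eval f g p = (\<Sum>m\<in>Poly_Mapping.keys p. f (Poly_Mapping.lookup p m) * monom_value g m)"

context
  fixes f :: "'a::comm_ring_1 \<Rightarrow> 'b::comm_ring_1" and g :: "'v \<Rightarrow> 'b"
  assumes f: "comm_ring_hom f"
begin

interpretation comm_ring_hom f by (rule f)

lemma mpoly_eval_superset: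
  "finite M \<Longrightarrow> Poly_Mapping.keys p \<subseteq> M \<Longrightarrow> mpoly_eval f g p = (\<Sum>m\<in>M. f (Poly_Mapping.lookup p m) * monom_value g m)"
  unfolding mpoly_eval_def by (rule sum.mono_neutral_left) (auto simp: in_keys_iff)

lemma mpoly_eval_single: "mpoly_eval f g (Poly_Mapping.single m c) = f c * monom_value g m"
  by (cases "c = 0") (simp_all add: mpoly_eval_def)

lemma mpoly_eval_Const: "mpoly_eval f g (Const c) = f c"
  by (simp add: Const_def mpoly_eval_single)

lemma mpoly_eval_Var: "mpoly_eval f g (Var v) = g v"
  by (simp add: Var_def mpoly_eval_single)

lemma mpoly_eval_add: "mpoly_eval f g (p + q) = mpoly_eval f g p + mpoly_eval f g q"
proof -
  let ?M = "Poly_Mapping.keys p \<union> Poly_Mapping.keys q"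
  have "Poly_Mapping.keys (p + q) \<subseteq> ?M" by (rule Poly_Mapping.keys_add)
  then show ?thesis
    by (simp add: mpoly_eval_superset[of ?M] lookup_add hom_add distrib_right sum.distrib)
qed

lemma mpoly_eval_sum: "mpoly_eval f g (sum P I) = (\<Sum>i\<in>I. mpoly_eval f g (P i))"
  by (induction I rule: infinite_finite_induct) (simp_all add: mpoly_eval_add, simp_all add: mpoly_eval_def)

lemma mpoly_eval_mult: "mpoly_eval f g (p * q) = mpoly_eval f g p * mpoly_eval f g q"
proof -
  have "p * q = (\<Sum>m\<in>Poly_Mapping.keys p. \<Sum>n\<in>Poly_Mapping.keys q.
      Poly_Mapping.single (m + n) (Poly_Mapping.lookup p m * Poly_Mapping.lookup q n))"
    by (subst sum_single_lookup[of p, symmetric], subst sum_single_lookup[of q, symmetric])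
      (simp add: sum_product mult_single)
  then show ?thesis
    by (simp add: mpoly_eval_sum mpoly_eval_single hom_mult monom_value_add)
      (simp add: mpoly_eval_def sum_product mult_ac)
qed

lemma comm_ring_hom_mpoly_eval: "comm_ring_hom (mpoly_eval f g)"
proof unfold_locales
  show "mpoly_eval f g 0 = 0" by (simp add: mpoly_eval_def)
  show "mpoly_eval f g 1 = 1" using mpoly_eval_single[of 0 1] by simp
qed (simp_all add: mpoly_eval_add mpoly_eval_mult)

end

text \<open>Each monomial is a constant times a product of powers of variables. This reduces
  statements about homomorphic images to constants, variables and ring operations.\<close>

lemma mpoly_induct [case_names Const Var add mult]:
  assumes Const: "\<And>c. P (Const c)" and Var: "\<And>v. P (Var v)"
    and add: "\<And>p q. P p \<Longrightarrow> P q \<Longrightarrow> P (p + q)"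
    and mult: "\<And>p q. P p \<Longrightarrow> P q \<Longrightarrow> P (p * q)"
  shows "P (p :: ('v, 'a::comm_ring_1) mpoly)"
proof -
  have P_0: "P 0" and P_1: "P 1" using Const[of 0] Const[of 1] by (simp_all add: Const_def)
  have P_sum: "P (sum h I)" if "finite I" "\<And>i. i \<in> I \<Longrightarrow> P (h i)" for h and I :: "('v \<Rightarrow>\<^sub>0 nat) set"
    using that by (induction I rule: finite_induct) (auto intro: P_0 add)
  have P_prod: "P (prod h I)" if "finite I" "\<And>i. i \<in> I \<Longrightarrow> P (h i)" for h and I :: "'v set"
    using that by (induction I rule: finite_induct) (auto intro: P_1 mult)
  have pow: "Poly_Mapping.single (Poly_Mapping.single v k) 1 = (Var v :: ('v, 'a) mpoly) ^ k" for v k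
  proof (induction k)
    case (Suc k)
    have "Poly_Mapping.single (Poly_Mapping.single v (Suc k)) (1 :: 'a)
        = Var v * Poly_Mapping.single (Poly_Mapping.single v k) 1"
      by (simp add: Var_def mult_single flip: single_add)
    with Suc show ?case by simp
  qed simp
  have P_pow: "P (Var v ^ k)" for v k
    by (induction k) (auto intro: P_1 mult Var)
  have monom: "P (Poly_Mapping.single m 1)" for m
  proof -
    have "Poly_Mapping.single m (1 :: 'a) = (\<Prod>v\<in>Poly_Mapping.keys m. Var v ^ Poly_Mapping.lookup m v)"
    proof -
      have "Poly_Mapping.single (\<Sum>v\<in>V. Poly_Mapping.single v (Poly_Mapping.lookup m v)) (1 :: 'a)
          = (\<Prod>v\<in>V. Var v ^ Poly_Mapping.lookup m v)" if "finite V" for V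
        using that
      proof (induction V rule: finite_induct)
        case (insert v V)
        have "Poly_Mapping.single (\<Sum>v\<in>insert v V. Poly_Mapping.single v (Poly_Mapping.lookup m v)) (1 :: 'a)
            = Poly_Mapping.single (Poly_Mapping.single v (Poly_Mapping.lookup m v)) 1
              * Poly_Mapping.single (\<Sum>v\<in>V. Poly_Mapping.single v (Poly_Mapping.lookup m v)) 1"
          using insert.hyps by (simp add: mult_single)
        also have "\<dots> = (\<Prod>v\<in>insert v V. Var v ^ Poly_Mapping.lookup m v)"
          unfolding pow insert.IH using insert.hyps by simp
        finally show ?case .
      qed simp
      from this[of "Poly_Mapping.keys m"] show ?thesis by (simp add: sum_single_lookup)
    qed
    also have "P \<dots>" by (intro P_prod P_pow) auto
    finally show ?thesis .
  qed
  have "P (Poly_Mapping.single m c)" for m c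
  proof -
    have "Poly_Mapping.single m c = Const c * Poly_Mapping.single m 1"
      by (simp add: Const_def mult_single)
    then show ?thesis by (metis mult Const monom)
  qed
  then have "P (\<Sum>m\<in>Poly_Mapping.keys p. Poly_Mapping.single m (Poly_Mapping.lookup p m))"
    by (intro P_sum) auto
  then show ?thesis by (simp add: sum_single_lookup)
qed

section \<open>Lowest-order coefficients of univariate polynomials\<close>

lemma low_order_mult:
  fixes p q :: "'a::comm_ring_1 poly"
  assumes "monom 1 m dvd p" "monom 1 n dvd q"
  shows "monom 1 (m + n) dvd p * q" "coeff (p * q) (m + n) = coeff p m * coeff q n"
proof -
  obtain p' q' where p: "p = monom 1 m * p'" and q: "q = monom 1 n * q'"
    using assms by (auto simp: dvd_def)
  have pq: "p * q = monom 1 (m + n) * (p' * q')"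
    unfolding p q by (simp add: mult_monom[of "1::'a" m 1 n, simplified, symmetric] mult_ac)
  then show "monom 1 (m + n) dvd p * q" by simp
  show "coeff (p * q) (m + n) = coeff p m * coeff q n"
    unfolding pq by (simp add: p q coeff_monom_mult coeff_mult_0)
qed

text \<open>Divisibility by \<open>monom 1 n\<close> encodes order at least \<open>n\<close>. In
  degree \<open>n\<close> only the constant terms of the coefficients survive, which is how matrices
  over the field arise from matrices over the polynomial ring.\<close>

lemma low_order_lincomb:
  fixes c p :: "'i \<Rightarrow> 'a::comm_ring_1 poly"
  assumes "\<And>i. i \<in> I \<Longrightarrow> monom 1 n dvd p i"
  shows "monom 1 n dvd (\<Sum>i\<in>I. c i * p i)"
    and "coeff (\<Sum>i\<in>I. c i * p i) n = (\<Sum>i\<in>I. coeff (c i) 0 * coeff (p i) n)"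
proof -
  show "monom 1 n dvd (\<Sum>i\<in>I. c i * p i)"
    using assms by (intro dvd_sum dvd_mult) auto
  show "coeff (\<Sum>i\<in>I. c i * p i) n = (\<Sum>i\<in>I. coeff (c i) 0 * coeff (p i) n)"
    unfolding coeff_sum
    by (intro sum.cong refl low_order_mult(2)[of 0 _ n, simplified]) (simp_all add: assms)
qed

section \<open>Restriction to lines through the origin\<close>

text \<open>
  \<open>line a p\<close> is the restriction of \<open>p\<close> to the line through the origin and \<open>a\<close>, so its coefficients
  are the values at \<open>a\<close> of the homogeneous components of \<open>p\<close> (with \<open>t\<close> in degree \<open>1\<close>).
\<close>

type_synonym 'k point = "svar + tauvar \<Rightarrow> 'k"

definition line_S :: "'k::field point \<Rightarrow> 'k S \<Rightarrow> 'k poly" where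
  "line_S a = mpoly_eval (\<lambda>c. [:c:]) (\<lambda>v. monom (a (Inl v)) 1)"

definition line :: "'k::field point \<Rightarrow> 'k S_ext \<Rightarrow> 'k poly" where
  "line a = mpoly_eval (line_S a) (\<lambda>v. monom (a (Inr v)) 1)"

lemma comm_ring_hom_const_poly: "comm_ring_hom (\<lambda>c :: 'k::field. [:c:])"
  by unfold_locales (simp_all add: one_pCons)

lemma comm_ring_hom_line_S: "comm_ring_hom (line_S a)"
  unfolding line_S_def by (rule comm_ring_hom_mpoly_eval[OF comm_ring_hom_const_poly])

lemma comm_ring_hom_line: "comm_ring_hom (line a)"
  unfolding line_def by (rule comm_ring_hom_mpoly_eval[OF comm_ring_hom_line_S])

interpretation line_S: comm_ring_hom "line_S a" for a by (rule comm_ring_hom_line_S)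
interpretation line: comm_ring_hom "line a" for a by (rule comm_ring_hom_line)

lemma line_S_Const: "line_S a (Const c) = [:c:]"
  unfolding line_S_def by (rule mpoly_eval_Const[OF comm_ring_hom_const_poly])

lemma line_S_Var: "line_S a (Var v) = monom (a (Inl v)) 1"
  unfolding line_S_def by (rule mpoly_eval_Var[OF comm_ring_hom_const_poly])

lemma line_Const: "line a (Const c) = line_S a c"
  unfolding line_def by (rule mpoly_eval_Const[OF comm_ring_hom_line_S])

lemma line_Var: "line a (Var v) = monom (a (Inr v)) 1"
  unfolding line_def by (rule mpoly_eval_Var[OF comm_ring_hom_line_S])

text \<open>Restriction to the degenerate line at the origin; \<open>coeff_line_0\<close> shows that
  every line gives the same value.\<close>

definition const_part :: "'k::field S_ext \<Rightarrow> 'k" where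
  "const_part p = coeff (line (\<lambda>_. 0) p) 0"

lemma coeff_1_mult: "coeff (p * q) 1 = coeff p 0 * coeff q 1 + coeff p 1 * coeff q (0::nat)"
  by (simp add: coeff_mult)

lemma coeff_line_S_0: "coeff (line_S a p) 0 = coeff (line_S b p) 0"
  by (induction p rule: mpoly_induct)
    (simp_all add: line_S_Const line_S_Var line_S.hom_add line_S.hom_mult coeff_mult_0)

lemma coeff_line_0: "coeff (line a p) 0 = const_part p"
  unfolding const_part_def
  by (induction p rule: mpoly_induct)
    (simp_all add: line_Const line_Var line.hom_add line.hom_mult coeff_mult_0 coeff_line_S_0)

text \<open>By the product rule, the linear coefficient of \<open>p * q\<close> mixes linear
  coefficients only with constant terms, and these do not depend on the point.\<close>

lemma coeff_line_S_1:
  "coeff (line_S (\<lambda>v. a v + b v) p) 1 = coeff (line_S a p) 1 + coeff (line_S b p) 1"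
proof (induction p rule: mpoly_induct)
  case (mult p q)
  then show ?case
    using coeff_line_S_0[of a _ "\<lambda>v. a v + b v"] coeff_line_S_0[of b _ "\<lambda>v. a v + b v"]
    by (simp add: line_S.hom_mult coeff_1_mult algebra_simps del: One_nat_def)
qed (simp_all add: line_S_Const line_S_Var line_S.hom_add)

lemma coeff_line_1:
  "coeff (line (\<lambda>v. a v + b v) p) 1 = coeff (line a p) 1 + coeff (line b p) 1"
proof (induction p rule: mpoly_induct)
  case (Const c)
  show ?case unfolding line_Const by (rule coeff_line_S_1)
next
  case (mult p q)
  then show ?case
    by (simp add: line.hom_mult coeff_1_mult coeff_line_0 algebra_simps del: One_nat_def)
qed (simp_all add: line_Var line.hom_add)

section \<open>The generators of the Kustin-Miller ideal\<close>

definition minor2 :: "(row3 \<Rightarrow> col4 \<Rightarrow> 'a::comm_ring_1) \<Rightarrow> row3 \<Rightarrow> row3 \<Rightarrow> col4 \<Rightarrow> col4 \<Rightarrow> 'a" where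
  "minor2 A i i' j k = A i j * A i' k - A i k * A i' j"

definition minor3 :: "(row3 \<Rightarrow> col4 \<Rightarrow> 'a::comm_ring_1) \<Rightarrow> col4 \<Rightarrow> col4 \<Rightarrow> col4 \<Rightarrow> 'a" where
  "minor3 A j k l = A R1 j * minor2 A R2 R3 k l - A R2 j * minor2 A R1 R3 k l
     + A R3 j * minor2 A R1 R2 k l"

text \<open>The elements \<open>x_j v +- M_j\<close> come first, the \<open>q_i\<close> last. Stated
  over any commutative ring, the formula serves both in \<open>R_KM\<close> and for images under a
  homomorphism.\<close>

definition km_gen ::
    "(col4 \<Rightarrow> 'a::comm_ring_1) \<Rightarrow> (row3 \<Rightarrow> col4 \<Rightarrow> 'a) \<Rightarrow> 'a \<Rightarrow> nat \<Rightarrow> 'a" where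
  "km_gen x A v i =
     [x C1 * v + minor3 A C2 C3 C4, x C2 * v - minor3 A C1 C3 C4,
      x C3 * v + minor3 A C1 C2 C4, x C4 * v - minor3 A C1 C2 C3,
      \<Sum>j\<in>{C1, C2, C3, C4}. A R1 j * x j, \<Sum>j\<in>{C1, C2, C3, C4}. A R2 j * x j,
      \<Sum>j\<in>{C1, C2, C3, C4}. A R3 j * x j] ! i"

lemma lessThan_7: "{..<7} = {0, 1, 2, 3, 4, 5, 6 :: nat}"
  by auto

lemma km_gen_nth:
  "km_gen x A v 0 = x C1 * v + minor3 A C2 C3 C4"
  "km_gen x A v (Suc 0) = x C2 * v - minor3 A C1 C3 C4"
  "km_gen x A v 1 = x C2 * v - minor3 A C1 C3 C4"
  "km_gen x A v 2 = x C3 * v + minor3 A C1 C2 C4"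
  "km_gen x A v 3 = x C4 * v - minor3 A C1 C2 C3"
  "km_gen x A v 4 = (\<Sum>j\<in>{C1, C2, C3, C4}. A R1 j * x j)"
  "km_gen x A v 5 = (\<Sum>j\<in>{C1, C2, C3, C4}. A R2 j * x j)"
  "km_gen x A v 6 = (\<Sum>j\<in>{C1, C2, C3, C4}. A R3 j * x j)"
  by (simp_all add: km_gen_def)

text \<open>In the first three, \<open>v\<close> cancels and what remains is a Laplace expansion:
  the minors on two columns combine the \<open>q_i\<close> into the \<open>x_j\<close> times maximal
  minors. In the last three, the maximal minors cancel as the expansion of a determinant with a
  repeated row.\<close>

lemma km_syzygies:
  fixes x :: "col4 \<Rightarrow> 'a::comm_ring_1" and A v
  defines "g \<equiv> km_gen x A v"
  shows "x C2 * g 0 - x C1 * g 1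
      = minor2 A R2 R3 C3 C4 * g 4 - minor2 A R1 R3 C3 C4 * g 5 + minor2 A R1 R2 C3 C4 * g 6"
    and "x C3 * g 0 - x C1 * g 2
      = - minor2 A R2 R3 C2 C4 * g 4 + minor2 A R1 R3 C2 C4 * g 5 - minor2 A R1 R2 C2 C4 * g 6"
    and "x C3 * g 1 - x C2 * g 2
      = minor2 A R2 R3 C1 C4 * g 4 - minor2 A R1 R3 C1 C4 * g 5 + minor2 A R1 R2 C1 C4 * g 6"
    and "A R1 C1 * g 0 + A R1 C2 * g 1 + A R1 C3 * g 2 + A R1 C4 * g 3 = v * g 4"
    and "A R2 C1 * g 0 + A R2 C2 * g 1 + A R2 C3 * g 2 + A R2 C4 * g 3 = v * g 5"
    and "A R3 C1 * g 0 + A R3 C2 * g 1 + A R3 C3 * g 2 + A R3 C4 * g 3 = v * g 6"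
  unfolding g_def km_gen_nth minor3_def minor2_def
  by (simp_all add: ring_distribs ac_simps)

section \<open>Determinants of size two and three\<close>

lemma det_2_carrier:
  assumes "A \<in> carrier_mat 2 2"
  shows "det (A :: 'a::comm_ring_1 mat) = A $$ (0, 0) * A $$ (1, 1) - A $$ (1, 0) * A $$ (0, 1)"
proof -
  have "det (mat_delete A i 0) = mat_delete A i 0 $$ (0, 0)" for i
    using assms by (intro det_single carrier_matI) auto
  moreover have "{..<2} = {0, 1 :: nat}" by auto
  ultimately show ?thesis
    using laplace_expansion_column[OF assms, of 0] assms
    by (simp add: cofactor_def mat_delete_def)
qed

lemma det_3_carrier:
  assumes "A \<in> carrier_mat 3 3"
  shows "det (A :: 'a::comm_ring_1 mat) =
      A $$ (0, 0) * (A $$ (1, 1) * A $$ (2, 2) - A $$ (2, 1) * A $$ (1, 2))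
    - A $$ (1, 0) * (A $$ (0, 1) * A $$ (2, 2) - A $$ (2, 1) * A $$ (0, 2))
    + A $$ (2, 0) * (A $$ (0, 1) * A $$ (1, 2) - A $$ (1, 1) * A $$ (0, 2))"
proof -
  have "mat_delete A i 0 \<in> carrier_mat 2 2" for i
    using assms by (intro carrier_matI) auto
  note det_2_carrier[OF this]
  moreover have "{..<3} = {0, 1, 2 :: nat}" by auto
  moreover have "dim_row A = 3" "dim_col A = 3" using assms by auto
  ultimately show ?thesis
    using laplace_expansion_column[OF assms, of 0] 
    by (simp add: cofactor_def mat_delete_def numeral_2_eq_2 numeral_3_eq_3 right_diff_distrib)
qed
lemma minor_eq: "minor j k l = minor3 (\<lambda>i j. Var (KA i j)) j k l"
proof -
  have carrier: "mat_of_rows_list 3 (map (\<lambda>i. [Var (KA i j), Var (KA i k), Var (KA i l)]) [R1, R2, R3])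
      \<in> carrier_mat 3 3"
    by (rule carrier_matI)
      (simp_all only: mat_of_rows_list_def dim_row_mat dim_col_mat list.map length_Cons list.size)
  show ?thesis
    unfolding minor_def minor3_def minor2_def det_3_carrier[OF carrier]
    by (simp only: mat_of_rows_list_def dim_row_mat dim_col_mat list.map length_Cons list.size index_mat)
      (simp add: mult.commute)
qed

definition km_ideal_gen :: "nat \<Rightarrow> 'k::field R_KM" where
  "km_ideal_gen = km_gen (\<lambda>j. Var (KX j)) (\<lambda>i j. Var (KA i j)) (Var KV)"

lemma I_KM_eq: "(I_KM :: 'k::field R_KM set) = ideal_gen (km_ideal_gen ` {..<7})"
  unfolding I_KM_def lessThan_7 km_ideal_gen_def
  by (rule arg_cong[of _ _ ideal_gen])
    (simp only: image_insert image_empty km_gen_nth qc_def minor_eq, blast)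

lemma hom_km_gen:
  assumes "comm_ring_hom \<phi>" "i < 7"
  shows "\<phi> (km_gen x A v i) = km_gen (\<lambda>j. \<phi> (x j)) (\<lambda>i j. \<phi> (A i j)) (\<phi> v) i"
proof -
  interpret comm_ring_hom \<phi> by fact
  have "i \<in> {0, 1, 2, 3, 4, 5, 6}" using assms(2) by auto
  then show ?thesis
    by (auto simp: km_gen_nth minor3_def minor2_def hom_distribs)
qed

section \<open>The generators of the doubled ideal\<close>

text \<open>The last index is reserved for \<open>u(t)\<close>, the only generator without a cubic
  part on \<open>t = 0\<close>.\<close>

definition I_gen :: "nat \<Rightarrow> 'k::field S_ext" where
  "I_gen i =
     [Const (- u234 + z234 * tc), Const (- u134 + z134 * tc), Const (- u124 + z124 * tc),
      Const (- u123 - z123 * tc), f1, f2, Const (u0 - tc\<^sup>2)] ! i"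

lemma I_t_eq: "I_t = ideal_gen (I_gen ` {..<7})"
  unfolding I_t_def J_gens_def lessThan_7
  by (rule arg_cong[of _ _ ideal_gen]) (auto simp: I_gen_def)

section \<open>Quadratic and cubic parts of the generators\<close>

definition t_val :: "'k::field point \<Rightarrow> 'k" where "t_val a = a (Inl VT)"

text \<open>These are the linear forms \<open>w_i\<close>: the quadratic part of
  \<open>I_gen i\<close> is \<open>t\<close> times the \<open>i\<close>-th one.\<close>

definition t_cofactor :: "'k::field point \<Rightarrow> nat \<Rightarrow> 'k" where
  "t_cofactor a i =
     [a (Inl (VZ P234)), a (Inl (VZ P134)), a (Inl (VZ P124)), - a (Inl (VZ P123)),
      - a (Inr T5), - a (Inr T6), - a (Inl VT)] ! i"

lemma skew_Var: "line_S a (skew (\<lambda>p. Var (V p)) i j) = monom (skew (\<lambda>p. a (Inl (V p))) i j) 1"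
  by (simp add: skew_def line_S_Var line_S.hom_uminus minus_monom)

lemma numeral_mult_monom: "numeral k * monom c n = monom (numeral k * c :: 'a::comm_ring_1) n"
  by (simp add: numeral_poly smult_monom)

lemma monom_power: "(monom c n) ^ k = monom (c ^ k :: 'a::comm_ring_1) (n * k)"
  by (induction k) (simp_all add: mult_monom one_pCons monom_0 add.commute)

lemma monom_mult_numeral: "monom c n * numeral k = monom (numeral k * c :: 'a::comm_ring_1) n"
  by (simp add: numeral_mult_monom mult.commute[of _ "numeral k"])

lemma line_numeral: "line_S a (numeral k) = numeral k" "line a (numeral k) = numeral k"
  by (induction k) (simp_all only: numeral.simps line_S.hom_one line_S.hom_add line.hom_one line.hom_add)

lemmas monom_arith = mult_monom add_monom minus_monom diff_monom numeral_mult_monom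
  monom_mult_numeral monom_power

lemma line_S_basic:
  "line_S a (xc i j) = monom (skew (\<lambda>p. a (Inl (VX p))) i j) 1"
  "line_S a (yc i j) = monom (skew (\<lambda>p. a (Inl (VY p))) i j) 1"
  "line_S a z123 = monom (a (Inl (VZ P123))) 1"
  "line_S a z124 = monom (a (Inl (VZ P124))) 1"
  "line_S a z134 = monom (a (Inl (VZ P134))) 1"
  "line_S a z234 = monom (a (Inl (VZ P234))) 1"
  "line_S a tc = monom (a (Inl VT)) 1"
  by (simp_all add: xc_def yc_def skew_Var z123_def z124_def z134_def z234_def tc_def line_S_Var)

lemmas line_S_eval = line_S_basic monom_arith line_numeral
  line_S.hom_add line_S.hom_mult line_S.hom_uminus line_S.hom_minus line_S.hom_power

lemma atLeastAtMost_4_minus: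
  "{Suc 0..4} - {Suc 0} = {2, 3, 4 :: nat}" "{Suc 0..4} - {2} = {1, 3, 4 :: nat}"
  "{Suc 0..4} - {3} = {1, 2, 4 :: nat}" "{Suc 0..4} - {4} = {1, 2, 3 :: nat}"
  by auto

lemma uc_expand:
  "uc 1 = xc 2 1 * z134 - xc 3 1 * z124 + xc 4 1 * z123"
  "uc 2 = - xc 1 2 * z234 - xc 3 2 * z124 + xc 4 2 * z123"
  "uc 3 = - xc 1 3 * z234 + xc 2 3 * z134 + xc 4 3 * z123"
  "uc 4 = - xc 1 4 * z234 + xc 2 4 * z134 - xc 3 4 * z124"
  by (simp_all add: uc_def atLeastAtMost_4_minus zhat_def)

lemma vc_expand:
  "vc 1 = yc 2 1 * z134 - yc 3 1 * z124 + yc 4 1 * z123"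
  "vc 2 = - yc 1 2 * z234 - yc 3 2 * z124 + yc 4 2 * z123"
  "vc 3 = - yc 1 3 * z234 + yc 2 3 * z134 + yc 4 3 * z123"
  "vc 4 = - yc 1 4 * z234 + yc 2 4 * z134 - yc 3 4 * z124"
  by (simp_all add: vc_def atLeastAtMost_4_minus zhat_def)

lemmas S_defs = u123_def u124_def u134_def u234_def \<delta>1_def \<delta>2_def \<delta>3_def \<Delta>_def
  pa_def pb_def pc_def u0_def uc_expand vc_expand f1_def f2_def

lemmas line_eval = line_Const line_Var line.hom_add line.hom_mult line.hom_uminus line.hom_minus line.hom_power

text \<open>Evaluation on a line collapses a homogeneous polynomial to a single
  \<open>monom\<close>; its coefficient stays existential because only the degrees matter
  here.\<close>

lemma line_I_gen_cubic:
  assumes "i < 6"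
  shows "\<exists>N. line a (I_gen i) = monom (t_val a * t_cofactor a i) 2 + monom N 3"
proof -
  have "\<exists>N. line_S a u234 = monom N 3" "\<exists>N. line_S a u134 = monom N 3"
    "\<exists>N. line_S a u124 = monom N 3" "\<exists>N. line_S a u123 = monom N 3"
    by (simp_all add: S_defs line_S_eval numeral_3_eq_3)
  \<comment> \<open>Adding \<tau>5 t and \<tau>6 t cancels the quadratic terms, so that only
    homogeneous cubics remain.\<close>
  moreover have "\<exists>N. line a f1 + monom (a (Inr T5) * a (Inl VT)) 2 = monom N 3"
    "\<exists>N. line a f2 + monom (a (Inr T6) * a (Inl VT)) 2 = monom N 3"
    unfolding S_defs
    by (simp_all add: line_eval line_S_eval numeral_3_eq_3 numeral_2_eq_2)
  ultimately obtain N0 N1 N2 N3 N4 N5 where N: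
    "line_S a u234 = monom N0 3" "line_S a u134 = monom N1 3"
    "line_S a u124 = monom N2 3" "line_S a u123 = monom N3 3"
    "line a f1 + monom (a (Inr T5) * a (Inl VT)) 2 = monom N4 3"
    "line a f2 + monom (a (Inr T6) * a (Inl VT)) 2 = monom N5 3"
    by blast
  have "line a f1 = monom N4 3 - monom (a (Inr T5) * a (Inl VT)) 2"
    "line a f2 = monom N5 3 - monom (a (Inr T6) * a (Inl VT)) 2"
    unfolding N[symmetric] by simp_all
  moreover have "i \<in> {0, 1, 2, 3, 4, 5}" using assms by auto
  ultimately have "line a (I_gen i) - monom (t_val a * t_cofactor a i) 2
      \<in> {- monom N0 3, - monom N1 3, - monom N2 3, - monom N3 3, monom N4 3, monom N5 3}"
    by (auto simp: I_gen_def t_val_def t_cofactor_def line_eval line_S_eval N mult.commute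
      numeral_2_eq_2 simp flip: minus_monom)
  then have "\<exists>N. line a (I_gen i) - monom (t_val a * t_cofactor a i) 2 = monom N 3"
    by (auto simp: minus_monom)
  then show ?thesis by (auto simp: algebra_simps)
qed

lemma line_I_gen_quartic:
  "\<exists>N. line a (I_gen 6) = monom (t_val a * t_cofactor a 6) 2 + monom N 4"
proof -
  have "\<exists>N. line_S a u0 = monom N 4" 
    by (simp add: S_defs line_S_eval eval_nat_numeral)
  then obtain N where N: "line_S a u0 = monom N 4" by blast
  then have "line a (I_gen 6) = monom (t_val a * t_cofactor a 6) 2 + monom N 4"
    by (simp add: I_gen_def t_val_def t_cofactor_def line_eval line_S_eval N power2_eq_square numeral_2_eq_2)
  then show ?thesis by blast
qed

lemma
  assumes "i < 7"
  shows low_order_I_gen: "monom 1 2 dvd line a (I_gen i)"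
    and coeff_I_gen_2: "coeff (line a (I_gen i)) 2 = t_val a * t_cofactor a i"
    and low_order_I_gen_t_0: "t_val a = 0 \<Longrightarrow> monom 1 3 dvd line a (I_gen i)"
proof -
  \<comment> \<open>One of \<open>M\<close>, \<open>N\<close> is taken to be zero, which gives both
    cases a common form.\<close>
  have "i < 6 \<or> i = 6" using assms by auto
  then obtain M N where
    "line a (I_gen i) = monom (t_val a * t_cofactor a i) 2 + monom N 3 + monom M 4"
    using line_I_gen_cubic[of i a] line_I_gen_quartic[of a]
    by (metis add.right_neutral monom_eq_0)
  then show "monom 1 2 dvd line a (I_gen i)"
    "coeff (line a (I_gen i)) 2 = t_val a * t_cofactor a i"
    "t_val a = 0 \<Longrightarrow> monom 1 3 dvd line a (I_gen i)"
    by (simp_all add: monom_1_dvd_iff')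
qed

lemma coeff_I_gen_6_t_0: "t_val a = 0 \<Longrightarrow> coeff (line a (I_gen 6)) 3 = 0"
  using line_I_gen_quartic[of a] by auto

lemma t_cofactor_independent:
  fixes s :: "nat \<Rightarrow> 'k::field"
  assumes "\<And>a. t_val a = 1 \<Longrightarrow> (\<Sum>i<7. s i * t_cofactor a i) = 0" "i < 7"
  shows "s i = 0"
proof -
  \<comment> \<open>At \<open>e\<close> only the last form is nonzero, which gives
    \<open>s 6 = 0\<close>; switching on one further coordinate then isolates each other
    coefficient.\<close>
  define e :: "'k point" where "e = (\<lambda>_. 0)(Inl VT := 1)"
  have "t_val e = 1" "t_val (e(Inl (VZ p) := 1)) = 1" "t_val (e(Inr q := 1)) = 1" for p q
    by (simp_all add: e_def t_val_def)
  note assms(1)[OF this(1)] assms(1)[OF this(2), of P234] assms(1)[OF this(2), of P134]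
    assms(1)[OF this(2), of P124] assms(1)[OF this(2), of P123]
    assms(1)[OF this(3), of T5] assms(1)[OF this(3), of T6]
  then have "s 0 = 0" "s 1 = 0" "s 2 = 0" "s 3 = 0" "s 4 = 0" "s 5 = 0" "s 6 = 0"
    by (simp_all add: lessThan_7 t_cofactor_def e_def)
  moreover have "i \<in> {0, 1, 2, 3, 4, 5, 6}" using assms(2) by auto
  ultimately show ?thesis by auto
qed

lemma low_order_line: "const_part p = 0 \<Longrightarrow> monom 1 (Suc 0) dvd line a p"
  by (simp add: monom_1_dvd_iff' coeff_line_0)

section \<open>Presentations of the doubled ideal by Kustin-Miller generators\<close>

text \<open>Two generating families of the same ideal. \<open>C\<close> and \<open>D\<close> need
  not be inverse to each other, but their constant parts turn out to be.\<close>

locale km_presentation =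
  fixes x :: "col4 \<Rightarrow> 'k::field S_ext" and A :: "row3 \<Rightarrow> col4 \<Rightarrow> 'k S_ext" and v :: "'k S_ext"
    and C D :: "nat \<Rightarrow> nat \<Rightarrow> 'k S_ext"
  assumes km_gen_eq: "j < 7 \<Longrightarrow> km_gen x A v j = (\<Sum>i<7. D j i * I_gen i)"
    and I_gen_eq: "i < 7 \<Longrightarrow> I_gen i = (\<Sum>j<7. C i j * km_gen x A v j)"
begin

abbreviation g :: "nat \<Rightarrow> 'k S_ext" where "g \<equiv> km_gen x A v"

definition c :: "nat \<Rightarrow> nat \<Rightarrow> 'k" where "c i j = const_part (C i j)"

definition d :: "nat \<Rightarrow> nat \<Rightarrow> 'k" where "d j i = const_part (D j i)"

definition form :: "'k point \<Rightarrow> nat \<Rightarrow> 'k" where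
  "form a j = (\<Sum>i<7. d j i * t_cofactor a i)"

lemma line_g: "j < 7 \<Longrightarrow> line a (g j) = (\<Sum>i<7. line a (D j i) * line a (I_gen i))"
  by (simp add: km_gen_eq line.hom_sum line.hom_mult)

lemma low_order_g: "j < 7 \<Longrightarrow> monom 1 2 dvd line a (g j)"
  unfolding line_g by (intro low_order_lincomb(1) low_order_I_gen) simp

lemma coeff_g_2: "j < 7 \<Longrightarrow> coeff (line a (g j)) 2 = t_val a * form a j"
  unfolding line_g
  by (subst low_order_lincomb(2))
    (simp_all add: low_order_I_gen coeff_I_gen_2 coeff_line_0 form_def d_def sum_distrib_left mult_ac)

lemma low_order_g_t_0: "j < 7 \<Longrightarrow> t_val a = 0 \<Longrightarrow> monom 1 3 dvd line a (g j)"
  unfolding line_g by (intro low_order_lincomb(1) low_order_I_gen_t_0) simp_all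

lemma coeff_g_3:
  "j < 7 \<Longrightarrow> t_val a = 0 \<Longrightarrow> coeff (line a (g j)) 3 = (\<Sum>i<7. d j i * coeff (line a (I_gen i)) 3)"
  unfolding line_g
  by (subst low_order_lincomb(2)) (simp_all add: low_order_I_gen_t_0 coeff_line_0 d_def)

text \<open>Compare quadratic parts in \<open>I_gen_eq\<close> on \<open>t = 1\<close> and use the
  independence of the forms \<open>t_cofactor\<close>.\<close>

lemma c_d:
  assumes "i < 7" "k < 7"
  shows "(\<Sum>j<7. c i j * d j k) = (if i = k then 1 else 0)"
proof -
  define s where "s k = (\<Sum>j<7. c i j * d j k) - (if i = k then 1 else 0)" for k
  have "s k = 0"
  proof (rule t_cofactor_independent)
    fix a :: "'k point" assume t: "t_val a = 1"
    have "line a (I_gen i) = (\<Sum>j<7. line a (C i j) * line a (g j))"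
      unfolding I_gen_eq[OF assms(1)] by (simp add: line.hom_sum line.hom_mult)
    then have "coeff (line a (I_gen i)) 2 = (\<Sum>j<7. c i j * form a j)"
      using t by (simp only:) (subst low_order_lincomb(2),
        simp_all add: low_order_g coeff_g_2 coeff_line_0 c_def)
    then have "t_cofactor a i = (\<Sum>j<7. c i j * form a j)"
      using assms t by (simp add: coeff_I_gen_2)
    also have "\<dots> = (\<Sum>k<7. (\<Sum>j<7. c i j * d j k) * t_cofactor a k)"
      unfolding form_def sum_distrib_left sum_distrib_right mult.assoc
      by (rule sum.swap)
    finally show "(\<Sum>k<7. s k * t_cofactor a k) = 0"
      using assms(1) by (simp add: s_def left_diff_distrib sum_subtractf if_distrib[of "\<lambda>y. y * _"]
          sum.delta cong: if_cong)
  qed fact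
  then show ?thesis by (simp add: s_def)
qed

lemma d_c:
  assumes "j < 7" "l < 7"
  shows "(\<Sum>i<7. d j i * c i l) = (if j = l then 1 else 0)"
proof -
  let ?C = "mat 7 7 (\<lambda>(i, j). c i j)" and ?D = "mat 7 7 (\<lambda>(j, i). d j i)"
  have "?C * ?D = 1\<^sub>m 7"
    by (rule eq_matI) (simp_all add: scalar_prod_def c_d flip: lessThan_atLeast0)
  then have "?D * ?C = 1\<^sub>m 7"
    by (rule mat_mult_left_right_inverse[rotated 2]) simp_all
  then have "(?D * ?C) $$ (j, l) = 1\<^sub>m 7 $$ (j, l)" by simp
  with assms show ?thesis by (simp add: scalar_prod_def lessThan_atLeast0)
qed

text \<open>Since \<open>d\<close> is invertible, the forms \<open>form\<close> inherit independence
  from \<open>t_cofactor\<close>.\<close>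

lemma rows_independent:
  assumes "\<And>a. t_val a = 1 \<Longrightarrow> (\<Sum>j<7. s j * form a j) = 0" "l < 7"
  shows "s l = 0"
proof -
  have "(\<Sum>j<7. s j * d j i) = 0" if "i < 7" for i
  proof (rule t_cofactor_independent[OF _ that])
    fix a :: "'k point" assume "t_val a = 1"
    moreover have "(\<Sum>i<7. (\<Sum>j<7. s j * d j i) * t_cofactor a i) = (\<Sum>j<7. s j * form a j)"
      unfolding form_def sum_distrib_left sum_distrib_right mult.assoc by (rule sum.swap)
    ultimately show "(\<Sum>i<7. (\<Sum>j<7. s j * d j i) * t_cofactor a i) = 0" using assms(1) by simp
  qed
  then have "0 = (\<Sum>i<7. (\<Sum>j<7. s j * d j i) * c i l)" by simp
  also have "\<dots> = (\<Sum>j<7. s j * (\<Sum>i<7. d j i * c i l))"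
    unfolding sum_distrib_left sum_distrib_right mult.assoc by (rule sum.swap)
  also have "\<dots> = s l"
    using assms(2) by (simp add: d_c if_distrib[of "\<lambda>y. _ * y"] sum.delta cong: if_cong)
  finally show ?thesis by simp
qed

text \<open>In degree 2 a syzygy becomes a linear relation, with the constant parts as coefficients,
  among the independent quadratic parts of the \<open>g j\<close>.\<close>

lemma const_part_syzygy:
  assumes "(\<Sum>j<7. s j * g j) = 0" "l < 7"
  shows "const_part (s l) = 0"
proof (rule rows_independent[where s = "\<lambda>j. const_part (s j)", OF _ assms(2)])
  fix a :: "'k point" assume t: "t_val a = 1"
  have "(\<Sum>j<7. line a (s j) * line a (g j)) = 0"
    using assms(1) by (simp flip: line.hom_mult line.hom_sum)
  then have "0 = coeff (\<Sum>j<7. line a (s j) * line a (g j)) 2" by simp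
  also have "\<dots> = (\<Sum>j<7. const_part (s j) * form a j)"
    by (subst low_order_lincomb(2)) (simp_all add: low_order_g coeff_g_2 coeff_line_0 t)
  finally show "(\<Sum>j<7. const_part (s j) * form a j) = 0" ..
qed

section \<open>Vanishing of the constant terms\<close>

lemma const_part_x: "const_part (x C1) = 0" "const_part (x C2) = 0" "const_part (x C3) = 0"
proof -
  \<comment> \<open>Coefficient vectors of the first two identities in \<open>km_syzygies\<close>,
    brought to one side.\<close>
  let ?s = "\<lambda>j. [x C2, - x C1, 0, 0, - minor2 A R2 R3 C3 C4, minor2 A R1 R3 C3 C4,
    - minor2 A R1 R2 C3 C4] ! j"
  let ?s' = "\<lambda>j. [x C3, 0, - x C1, 0, minor2 A R2 R3 C2 C4, - minor2 A R1 R3 C2 C4,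
    minor2 A R1 R2 C2 C4] ! j"
  have s: "(\<Sum>j<7. ?s j * g j) = 0"
    using km_syzygies(1)[of x A v] by (simp add: lessThan_7 algebra_simps)
  have s': "(\<Sum>j<7. ?s' j * g j) = 0"
    using km_syzygies(2)[of x A v] by (simp add: lessThan_7 algebra_simps)
  show "const_part (x C2) = 0" using const_part_syzygy[OF s, of 0] by simp
  show "const_part (x C3) = 0" using const_part_syzygy[OF s', of 0] by simp
  show "const_part (x C1) = 0"
    using const_part_syzygy[OF s, of 1] by (simp add: const_part_def line.hom_uminus)
qed

lemma const_part_A_v: "const_part (A i j) = 0" "const_part v = 0"
proof -
  have s1: "(\<Sum>j<7. [A R1 C1, A R1 C2, A R1 C3, A R1 C4, - v, 0, 0] ! j * g j) = 0"
    using km_syzygies(4)[of A x v] by (simp add: lessThan_7 algebra_simps)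
  have s2: "(\<Sum>j<7. [A R2 C1, A R2 C2, A R2 C3, A R2 C4, 0, - v, 0] ! j * g j) = 0"
    using km_syzygies(5)[of A x v] by (simp add: lessThan_7 algebra_simps)
  have s3: "(\<Sum>j<7. [A R3 C1, A R3 C2, A R3 C3, A R3 C4, 0, 0, - v] ! j * g j) = 0"
    using km_syzygies(6)[of A x v] by (simp add: lessThan_7 algebra_simps)
  note const_part_syzygy[OF s1] const_part_syzygy[OF s2] const_part_syzygy[OF s3]
  note this[of 0] this[of 1] this[of 2] this[of 3]
  then show "const_part (A i j) = 0"
    by (cases i; cases j) simp_all
  show "const_part v = 0"
    using const_part_syzygy[OF s1, of 4] by (simp add: const_part_def line.hom_uminus)
qed

lemma low_order_minor2: "monom 1 2 dvd line a (minor2 A i i' j k)"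
proof -
  have "monom 1 (Suc 0 + Suc 0) dvd line a (A i j) * line a (A i' k)" for i i' j k
    by (intro low_order_mult(1) low_order_line const_part_A_v)
  then show ?thesis
    by (simp add: minor2_def line.hom_minus line.hom_mult numeral_2_eq_2 dvd_diff)
qed

lemma low_order_minor3: "monom 1 3 dvd line a (minor3 A j k l)"
proof -
  have "monom 1 (Suc 0 + 2) dvd line a (A i j) * line a (minor2 A i' i'' k l)" for i i' i''
    by (intro low_order_mult(1) low_order_line const_part_A_v low_order_minor2)
  then show ?thesis
    by (simp add: minor3_def line.hom_add line.hom_minus line.hom_mult dvd_diff dvd_add
        numeral_3_eq_3 numeral_2_eq_2)
qed

section \<open>Linear parts of \<open>x\<close> and \<open>v\<close>\<close>

definition x_lin :: "'k point \<Rightarrow> nat \<Rightarrow> 'k" where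
  "x_lin a j = coeff (line a (x ([C1, C2, C3] ! j))) 1"

definition v_lin :: "'k point \<Rightarrow> 'k" where "v_lin a = coeff (line a v) 1"

lemma x_lin_add: "x_lin (\<lambda>w. a w + b w) j = x_lin a j + x_lin b j"
  unfolding x_lin_def by (rule coeff_line_1)

lemma v_lin_add: "v_lin (\<lambda>w. a w + b w) = v_lin a + v_lin b"
  unfolding v_lin_def by (rule coeff_line_1)

lemma t_cofactor_add: "i < 7 \<Longrightarrow> t_cofactor (\<lambda>w. a w + b w) i = t_cofactor a i + t_cofactor b i"
proof -
  assume "i < 7"
  then have "i \<in> {0, 1, 2, 3, 4, 5, 6}" by auto
  then show ?thesis by (auto simp: t_cofactor_def)
qed

lemma form_add: "form (\<lambda>w. a w + b w) j = form a j + form b j"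
  by (simp add: form_def t_cofactor_add distrib_left sum.distrib)

lemma less_3_cases: "(j::nat) < 3 \<longleftrightarrow> j = 0 \<or> j = 1 \<or> j = 2"
  by auto

text \<open>The maximal minors have order at least 3, so \<open>g j\<close> and the product of
  \<open>x\<close> and \<open>v\<close> agree in degree 2.\<close>

lemma x_lin_v_lin:
  assumes "j < 3"
  shows "x_lin a j * v_lin a = t_val a * form a j"
proof -
  let ?y = "x ([C1, C2, C3] ! j)"
  have y: "const_part ?y = 0"
    using assms const_part_x by (auto simp: less_3_cases)
  have "coeff (line a ?y * line a v) (Suc 0 + Suc 0) = x_lin a j * v_lin a"
    unfolding x_lin_def v_lin_def One_nat_def
    by (intro low_order_mult(2) low_order_line const_part_A_v y)
  then have "coeff (line a (?y * v)) 2 = x_lin a j * v_lin a"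
    by (simp add: line.hom_mult numeral_2_eq_2)
  moreover have "coeff (line a (minor3 A k l m)) 2 = 0" for k l m
    using low_order_minor3[of a k l m] by (simp add: monom_1_dvd_iff')
  ultimately have "coeff (line a (g j)) 2 = x_lin a j * v_lin a"
    using assms by (auto simp: less_3_cases km_gen_nth line.hom_add line.hom_minus)
  then show ?thesis using assms coeff_g_2[of j a] by simp
qed

definition t_point :: "'k point" where "t_point = (\<lambda>_. 0)(Inl VT := 1)"

lemma t_val_add: "t_val (\<lambda>w. a w + b w) = t_val a + t_val b"
  by (simp add: t_val_def)

lemma t_val_t_point: "t_val t_point = 1"
  by (simp add: t_val_def t_point_def)

text \<open>
  If the linear part of \<open>v\<close> were not a multiple of \<open>t\<close>, then those of the \<open>x\<^sub>j\<close> would be, and the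
  quadratic parts of the \<open>p\<^sub>j\<close> would all be proportional.
\<close>

lemma v_lin_t_0:
  assumes "t_val b = 0"
  shows "v_lin b = 0"
proof (rule ccontr)
  assume b: "v_lin b \<noteq> 0"
  \<comment> \<open>If \<open>v_lin a\<close> is nonzero, it can be cancelled. Otherwise
    \<open>a + b\<close> still lies on \<open>t = 0\<close> and \<open>v_lin\<close> is nonzero
    there and at \<open>b\<close>.\<close>
  have x_0: "x_lin a j = 0" if "t_val a = 0" "j < 3" for a j
  proof (cases "v_lin a = 0")
    case True
    have "x_lin b j = 0"
      using x_lin_v_lin[of j b] that assms b by simp
    moreover have "x_lin (\<lambda>w. a w + b w) j = 0"
      using x_lin_v_lin[of j "\<lambda>w. a w + b w"] that assms b True by (simp add: v_lin_add t_val_add)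
    ultimately show ?thesis by (simp add: x_lin_add)
  next
    case False
    then show ?thesis using x_lin_v_lin[of j a] that by simp
  qed
  \<comment> \<open>A point with \<open>t = 1\<close> differs from \<open>t_point\<close> by one
    with \<open>t = 0\<close>, so \<open>x_lin\<close> is constant on \<open>t = 1\<close>.\<close>
  have form: "form a j = x_lin t_point j * v_lin a" if a: "t_val a = 1" and "j < 3" for a j
  proof -
    let ?a = "\<lambda>w. a w + - t_point w"
    have "t_val ?a = 0" using a by (simp add: t_val_def t_point_def)
    then have "x_lin ?a j = 0" using \<open>j < 3\<close> by (rule x_0)
    then have "x_lin (\<lambda>w. ?a w + t_point w) j = x_lin t_point j"
      using x_lin_add[of ?a t_point j] by simp
    then have "x_lin a j = x_lin t_point j" by simp
    then show ?thesis using x_lin_v_lin[of j a] that by simp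
  qed
  \<comment> \<open>The first two forms are multiples of \<open>v_lin\<close> on
    \<open>t = 1\<close>, and cross-multiplying gives a relation. It makes one factor zero, hence
    the whole form with index 1 zero on \<open>t = 1\<close>.\<close>
  let ?s = "\<lambda>j::nat. if j = 0 then x_lin t_point 1 else if j = 1 then - x_lin t_point 0 else 0"
  have "?s 0 = 0"
    by (rule rows_independent[where s = ?s]) (simp_all add: lessThan_7 form)
  then have x1: "x_lin t_point 1 = 0" by simp
  let ?s = "\<lambda>j::nat. if j = 1 then 1 else 0 :: 'k"
  have "?s 1 = 0"
    using x1 by (intro rows_independent[where s = ?s]) (simp_all add: lessThan_7 form)
  then show False by simp
qed

text \<open>On \<open>t = 0\<close> both sides of \<open>x_lin_v_lin\<close> vanish, so that
  identity is taken at \<open>a + t_point\<close> and at \<open>t_point\<close>, and the two are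
  subtracted.\<close>

lemma form_eq_x_lin:
  assumes "t_val a = 0" "j < 3"
  shows "form a j = x_lin a j * v_lin t_point"
proof -
  have "x_lin (\<lambda>w. a w + t_point w) j * v_lin (\<lambda>w. a w + t_point w)
      = form (\<lambda>w. a w + t_point w) j"
    using x_lin_v_lin[OF assms(2)] assms(1) by (simp add: t_val_add t_val_t_point)
  moreover have "x_lin t_point j * v_lin t_point = form t_point j"
    using x_lin_v_lin[OF assms(2), of t_point] by (simp add: t_val_t_point)
  ultimately show ?thesis
    using v_lin_t_0[OF assms(1)] by (simp add: x_lin_add v_lin_add form_add distrib_right)
qed

text \<open>On \<open>t = 0\<close> every \<open>g n\<close> has order at least 3 and every
  \<open>2 x 2\<close> minor at least 2. The first three syzygies thus have right sides of order 5,
  and their left sides vanish in degree 4.\<close>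

lemma x_lin_cubic:
  assumes t: "t_val a = 0" and "j < 3" "k < 3"
  shows "x_lin a k * coeff (line a (g j)) 3 = x_lin a j * coeff (line a (g k)) 3"
proof -
  have minor_g: "monom 1 5 dvd line a (minor2 A i i' l m) * line a (g n)" if "n < 7" for i i' l m n
    using low_order_mult(1)[OF low_order_minor2 low_order_g_t_0, of n a a i i' l m] that t by simp
  have x_g: "coeff (line a (x ([C1, C2, C3] ! l)) * line a (g n)) 4 = x_lin a l * coeff (line a (g n)) 3"
    if "l < 3" "n < 7" for l n
  proof -
    have "const_part (x ([C1, C2, C3] ! l)) = 0"
      using that const_part_x by (auto simp: less_3_cases)
    then show ?thesis
      using low_order_mult(2)[OF low_order_line low_order_g_t_0, of "x ([C1, C2, C3] ! l)" n a a] that t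
      by (simp add: x_lin_def eval_nat_numeral)
  qed
  have *: "x_lin a l * coeff (line a (g m)) 3 = x_lin a m * coeff (line a (g l)) 3"
    if "l < 3" "m < 3" and
     "monom 1 5 dvd line a (x ([C1, C2, C3] ! l) * g m - x ([C1, C2, C3] ! m) * g l)" for l m
  proof -
    have "coeff (line a (x ([C1, C2, C3] ! l) * g m - x ([C1, C2, C3] ! m) * g l)) 4 = 0"
      using that(3) by (simp add: monom_1_dvd_iff')
    then show ?thesis using that x_g[of l m] x_g[of m l] by (simp add: line.hom_minus line.hom_mult)
  qed
  have "monom 1 5 dvd line a (x C2 * g 0 - x C1 * g 1)"
    "monom 1 5 dvd line a (x C3 * g 0 - x C1 * g 2)"
    "monom 1 5 dvd line a (x C3 * g 1 - x C2 * g 2)"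
    unfolding km_syzygies
    by (simp_all add: line.hom_add line.hom_minus line.hom_mult line.hom_uminus
        minor_g dvd_diff dvd_add)
  then have "x_lin a 1 * coeff (line a (g 0)) 3 = x_lin a 0 * coeff (line a (g 1)) 3"
    "x_lin a 2 * coeff (line a (g 0)) 3 = x_lin a 0 * coeff (line a (g 2)) 3"
    "x_lin a 2 * coeff (line a (g 1)) 3 = x_lin a 1 * coeff (line a (g 2)) 3"
    using *[of 1 0] *[of 2 0] *[of 2 1] by simp_all
  then show ?thesis using assms(2,3) by (auto simp: less_3_cases)
qed

text \<open>Scaling by \<open>v_lin t_point\<close> eliminates \<open>x\<close> and
  \<open>v\<close>: the relation now involves only \<open>d\<close> and the explicit
  generators.\<close>

lemma form_cubic:
  assumes "t_val a = 0" "j < 3" "k < 3"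
  shows "form a k * coeff (line a (g j)) 3 = form a j * coeff (line a (g k)) 3"
  using x_lin_cubic[OF assms] assms by (simp add: form_eq_x_lin mult_ac)

end

section \<open>Points separating the quadratic and cubic parts\<close>

lemma two_neq_0:
  assumes "CHAR('k::field) \<noteq> 2"
  shows "(2 :: 'k) \<noteq> 0"
proof
  assume "(2 :: 'k) = 0"
  then have "CHAR('k) dvd 2"
    by (simp flip: of_nat_eq_0_iff_char_dvd)
  then have "CHAR('k) \<le> 2" "CHAR('k) \<noteq> 0" by (auto dest: dvd_imp_le intro!: Nat.gr0I)
  with assms have "CHAR('k) = Suc 0" by linarith
  then show False by simp
qed

lemma line_I_gen_t_0:
  assumes "t_val a = 0"
  shows "line a (I_gen 0) = - line_S a u234" "line a (I_gen (Suc 0)) = - line_S a u134"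
    "line a (I_gen 2) = - line_S a u124" "line a (I_gen 3) = - line_S a u123"
    "line a (I_gen 4) = line a f1" "line a (I_gen 5) = line a f2"
  using assms by (simp_all add: I_gen_def t_val_def line_eval line_S_eval)

text \<open>
  At a separating point only one of the products \<open>w\<^sub>i n\<^sub>i\<^sub>'\<close> does not vanish.
\<close>

definition separates :: "'k::field point \<Rightarrow> nat \<Rightarrow> nat \<Rightarrow> bool" where
  "separates a i i' \<longleftrightarrow> t_val a = 0 \<and> (\<forall>k<6. t_cofactor a k \<noteq> 0 \<longleftrightarrow> k = i) \<and>
     (\<forall>k<6. coeff (line a (I_gen k)) 3 \<noteq> 0 \<longleftrightarrow> k = i')"

lemma less_6: "(\<forall>k<6. Q k) \<longleftrightarrow> Q 0 \<and> Q (Suc 0) \<and> Q 2 \<and> Q 3 \<and> Q 4 \<and> Q (5::nat)"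
proof -
  have "k < 6 \<longleftrightarrow> k = 0 \<or> k = 1 \<or> k = 2 \<or> k = 3 \<or> k = 4 \<or> k = 5" for k :: nat by auto
  then show ?thesis by auto
qed

definition indicator_point :: "(svar + tauvar) list \<Rightarrow> 'k::field point" where
  "indicator_point ws w = (if w \<in> set ws then 1 else 0)"

text \<open>The three coordinates of each point form a monomial of the cubic with index
  \<open>i'\<close>, one of them being the variable of the form with index \<open>i\<close>. In the
  first six and the last, its coefficient is 2 up to sign, hence the hypothesis.\<close>

lemma separating_points:
  assumes "(2 :: 'k::field) \<noteq> 0"
  shows
    "separates (indicator_point [Inl (VZ P234), Inl (VX P13), Inl (VY P14)] :: 'k point) 0 1"
    "separates (indicator_point [Inl (VZ P234), Inl (VX P12), Inl (VY P14)] :: 'k point) 0 2"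
    "separates (indicator_point [Inl (VZ P234), Inl (VX P12), Inl (VY P13)] :: 'k point) 0 3"
    "separates (indicator_point [Inl (VZ P134), Inl (VX P12), Inl (VY P24)] :: 'k point) 1 2"
    "separates (indicator_point [Inl (VZ P134), Inl (VX P12), Inl (VY P23)] :: 'k point) 1 3"
    "separates (indicator_point [Inl (VZ P124), Inl (VX P13), Inl (VY P23)] :: 'k point) 2 3"
    "separates (indicator_point [Inl (VZ P234), Inl (VX P14), Inr T1] :: 'k point) 0 4"
    "separates (indicator_point [Inl (VZ P134), Inl (VX P24), Inr T1] :: 'k point) 1 4"
    "separates (indicator_point [Inl (VZ P124), Inl (VX P34), Inr T1] :: 'k point) 2 4"
    "separates (indicator_point [Inl (VZ P123), Inl (VX P14), Inr T4] :: 'k point) 3 4"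
    "separates (indicator_point [Inl (VZ P234), Inl (VY P14), Inr T1] :: 'k point) 0 5"
    "separates (indicator_point [Inl (VZ P134), Inl (VY P24), Inr T1] :: 'k point) 1 5"
    "separates (indicator_point [Inl (VZ P124), Inl (VY P34), Inr T1] :: 'k point) 2 5"
    "separates (indicator_point [Inl (VZ P123), Inl (VY P14), Inr T4] :: 'k point) 3 5"
    "separates (indicator_point [Inr T5, Inl (VY P12), Inl (VY P34)] :: 'k point) 4 5"
  unfolding separates_def less_6 using assms
  by (simp_all add: indicator_point_def line_I_gen_t_0 t_val_def t_cofactor_def S_defs
      uc_expand(1)[unfolded One_nat_def] vc_expand(1)[unfolded One_nat_def]
      line_eval line_S_eval skew_def pair4_of_def)

lemma exists_separating:
  assumes "(2 :: 'k::field) \<noteq> 0" "i < i'" "i' < 6"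
  shows "\<exists>a :: 'k point. separates a i i'"
proof -
  have "(i, i') \<in> {(0,1), (0,2), (0,3), (0,4), (0,5), (1,2), (1,3), (1,4), (1,5), (2,3), (2,4),
      (2,5), (3,4), (3,5), (4,5)}"
    using assms(2,3) by simp presburger
  then show ?thesis using separating_points[OF assms(1)] by auto
qed

lemma sum_single_index:
  fixes e :: "nat \<Rightarrow> 'a::comm_ring_1"
  assumes "i < n" "\<And>k. k < n \<Longrightarrow> k \<noteq> i \<Longrightarrow> w k = 0"
  shows "(\<Sum>k<n. e k * w k) = e i * w i"
proof -
  have "(\<Sum>k<n. e k * w k) = (\<Sum>k\<in>{i}. e k * w k)"
    using assms by (intro sum.mono_neutral_right) auto
  then show ?thesis by simp
qed

section \<open>The rank contradiction\<close>

context km_presentation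
begin

text \<open>At a separating point each sum in \<open>form_cubic\<close> reduces to one term, and the
  two nonzero factors cancel.\<close>

lemma d_minor_less:
  assumes "(2 :: 'k) \<noteq> 0" "i < i'" "i' < 6" "j < 3" "k < 3"
  shows "d k i * d j i' = d j i * d k i'"
proof -
  obtain a :: "'k point" where a: "separates a i i'"
    using exists_separating assms(1-3) by blast
  then have t: "t_val a = 0" by (simp add: separates_def)
  \<comment> \<open>\<open>separates\<close> constrains only indices below 6; at index 6 the form is
    \<open>-t\<close> and the cubic part is zero, so both vanish on \<open>t = 0\<close>.\<close>
  have lt_7: "l < 6 \<or> l = 6" if "l < 7" for l :: nat using that by auto
  have "t_cofactor a l = 0" if "l < 7" "l \<noteq> i" for l
    using a t that lt_7[of l] by (auto simp: separates_def t_cofactor_def t_val_def)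
  then have form: "form a l = d l i * t_cofactor a i" for l
    unfolding form_def using assms by (intro sum_single_index) auto
  have "coeff (line a (I_gen l)) 3 = 0" if "l < 7" "l \<noteq> i'" for l
    using a t that lt_7[of l] by (auto simp: separates_def coeff_I_gen_6_t_0)
  then have cubic: "coeff (line a (g l)) 3 = d l i' * coeff (line a (I_gen i')) 3" if "l < 3" for l
    using assms that t by (subst coeff_g_3) (auto intro!: sum_single_index)
  have "t_cofactor a i \<noteq> 0" "coeff (line a (I_gen i')) 3 \<noteq> 0"
    using a assms by (auto simp: separates_def)
  then show ?thesis
    using form_cubic[OF t assms(4,5)] assms(4,5) by (simp add: form cubic)
qed

lemma d_minor:
  assumes "(2 :: 'k) \<noteq> 0" "i < 6" "i' < 6" "j < 3" "k < 3"
  shows "d k i * d j i' = d j i * d k i'"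
  using d_minor_less[of i i' j k] d_minor_less[of i' i j k] assms
  by (cases i i' rule: linorder_cases) (simp_all add: mult.commute)

text \<open>Otherwise the \<open>3 x 3\<close> identity matrix would be a sum of two matrices of
  rank at most 1.\<close>

lemma two_eq_0: "(2 :: 'k) = 0"
proof (rule ccontr)
  assume 2: "(2 :: 'k) \<noteq> 0"
  \<comment> \<open>The product of \<open>d\<close> and \<open>c\<close> without the summand of
    index 6: the identity minus a matrix of rank at most 1.\<close>
  define m where "m j l = (\<Sum>i<6. d j i * c i l)" for j l
  have m: "m j l = (if j = l then 1 else 0) - d j 6 * c 6 l" if "j < 3" "l < 3" for j l
  proof -
    have "{..<7} = insert 6 {..<6 :: nat}" by auto
    then show ?thesis using d_c[of j l] that by (simp add: m_def eq_diff_eq add.commute)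
  qed
  \<comment> \<open>The vanishing minors of \<open>d\<close> pass to the product term by
    term.\<close>
  have minor: "m j l * m k n = m j n * m k l" if "j < 3" "k < 3" for j k l n
  proof -
    have swap: "(d j i * c i l) * (d k i' * c i' n) = (d k i * c i l) * (d j i' * c i' n)"
      if "i < 6" "i' < 6" for i i'
    proof -
      have "(d j i * c i l) * (d k i' * c i' n) = (d j i * d k i') * (c i l * c i' n)"
        by (simp add: mult_ac)
      also have "\<dots> = (d k i * d j i') * (c i l * c i' n)"
        unfolding d_minor[OF 2 that \<open>j < 3\<close> \<open>k < 3\<close>] ..
      finally show ?thesis by (simp add: mult_ac)
    qed
    have "m j l * m k n = (\<Sum>i<6. \<Sum>i'<6. (d j i * c i l) * (d k i' * c i' n))"
      by (simp only: m_def sum_product)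
    also have "\<dots> = (\<Sum>i<6. \<Sum>i'<6. (d k i * c i l) * (d j i' * c i' n))"
      using swap by (intro sum.cong) auto
    also have "\<dots> = m j n * m k l"
      by (simp only: m_def sum_product[symmetric] mult.commute)
    finally show ?thesis .
  qed
  define p q where "p j = d j 6" and "q j = c 6 j" for j
  note m' = m[folded p_def q_def]
  \<comment> \<open>The principal and the mixed \<open>2 x 2\<close> minors of the identity minus
    the outer product of \<open>p\<close> and \<open>q\<close>.\<close>
  have diag: "p 0 * q 0 + p 1 * q 1 = 1" "p 0 * q 0 + p 2 * q 2 = 1" "p 1 * q 1 + p 2 * q 2 = 1"
    using minor[of 0 1 0 1] minor[of 0 2 0 2] minor[of 1 2 1 2] by (simp_all add: m' algebra_simps)
  have off: "p 1 * q 2 = 0" "p 0 * q 2 = 0" "p 0 * q 1 = 0"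
    using minor[of 0 1 0 2] minor[of 1 0 1 2] minor[of 2 0 2 1] by (simp_all add: m' algebra_simps)
  show False
  proof (cases "p 0 = 0")
    case True
    with diag off show False by auto
  next
    case False
    with diag off show False by auto
  qed
qed

end

lemma ideal_gen_km_gen_neq_I_t:
  fixes x :: "col4 \<Rightarrow> 'k::field S_ext"
  assumes "CHAR('k) \<noteq> 2"
  shows "ideal_gen (km_gen x A v ` {..<7}) \<noteq> I_t"
proof
  assume eq: "ideal_gen (km_gen x A v ` {..<7}) = I_t"
  \<comment> \<open>The bound sits inside the existential so that the choice of coefficients is
    total in \<open>j\<close>.\<close>
  have "\<forall>j. \<exists>e. j < 7 \<longrightarrow> km_gen x A v j = (\<Sum>i<7. e i * I_gen i)"
    using eq ideal_gen_base[of _ "km_gen x A v ` {..<7}"] ideal_gen_imageD[of _ I_gen 7]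
    unfolding I_t_eq by blast
  then obtain D where D: "\<And>j. j < 7 \<Longrightarrow> km_gen x A v j = (\<Sum>i<7. D j i * I_gen i)"
    by metis
  have "\<forall>i. \<exists>e. i < 7 \<longrightarrow> I_gen i = (\<Sum>j<7. e j * km_gen x A v j)"
    using eq ideal_gen_base[of _ "I_gen ` {..<7}"] ideal_gen_imageD[of _ "km_gen x A v" 7]
    unfolding I_t_eq by blast
  then obtain C where C: "\<And>i. i < 7 \<Longrightarrow> I_gen i = (\<Sum>j<7. C i j * km_gen x A v j)"
    by metis
  interpret km_presentation x A v C D
    by unfold_locales (fact D C)+
  show False
    using two_eq_0 two_neq_0[OF assms] by blast
qed

section \<open>Zeroth homology of isomorphic complexes\<close>

text \<open>Base change carries any generating set \<open>B\<close> of the ideal to one of the new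
  ideal; the entries of \<open>G 0\<close> themselves may be a different generating set.\<close>

lemma base_change_H0:
  assumes \<phi>: "comm_ring_hom \<phi>" and G0: "G 0 \<in> carrier_mat 1 n"
    and H0: "(\<lambda>w. w $ 0) ` mat_image (G 0) = ideal_gen B"
  shows "(\<lambda>w. w $ 0) ` mat_image (base_change \<phi> G 0) = ideal_gen (\<phi> ` B)"
proof -
  have elements: "elements_mat (base_change \<phi> G 0) = \<phi> ` elements_mat (G 0)"
    using G0 by (subst (1 2) elements_mat_row) (auto simp: base_change_def)
  have "ideal_gen (elements_mat (G 0)) = ideal_gen B"
    using row_image_eq_ideal_gen[OF G0] H0 by simp
  then have "ideal_gen (\<phi> ` elements_mat (G 0)) = ideal_gen (\<phi> ` B)"
    using ideal_gen_hom[OF \<phi>, of B] ideal_gen_hom[OF \<phi>, of "elements_mat (G 0)"] ideal_gen_base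
    by (intro equalityI ideal_gen_subsetI) blast+
  then show ?thesis
    using row_image_eq_ideal_gen[of "base_change \<phi> G 0" n] G0 elements
    by (simp add: base_change_def)
qed

lemma row_image_mult_subset:
  assumes P: "P \<in> carrier_mat 1 1" and A: "A \<in> carrier_mat 1 m" and Q: "Q \<in> carrier_mat m n"
  shows "(\<lambda>w. w $ 0) ` mat_image (P * A * Q) \<subseteq> (\<lambda>w. w $ 0) ` mat_image (A :: 'a::comm_ring_1 mat)"
proof clarify
  fix y assume "y \<in> mat_image (P * A * Q)"
  then obtain w where w: "w \<in> carrier_vec n" and y: "y = P * A * Q *\<^sub>v w"
    using Q by (auto simp: mat_image_def)
  have Qw: "Q *\<^sub>v w \<in> carrier_vec m" using Q w by simp
  have "y = P *\<^sub>v (A *\<^sub>v (Q *\<^sub>v w))"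
    unfolding y assoc_mult_mat_vec[OF mult_carrier_mat[OF P A] Q w] assoc_mult_mat_vec[OF P A Qw] ..
  then have "y $ 0 = P $$ (0, 0) * (A *\<^sub>v (Q *\<^sub>v w)) $ 0"
    using P A by (simp add: scalar_prod_def)
  also have "\<dots> = (A *\<^sub>v (P $$ (0, 0) \<cdot>\<^sub>v (Q *\<^sub>v w))) $ 0"
    using A Q by (simp add: scalar_prod_def sum_distrib_left mult_ac)
  finally have "y $ 0 = (A *\<^sub>v (P $$ (0, 0) \<cdot>\<^sub>v (Q *\<^sub>v w))) $ 0" .
  moreover have "P $$ (0, 0) \<cdot>\<^sub>v (Q *\<^sub>v w) \<in> carrier_vec (dim_col A)"
    using A Qw by simp
  ultimately show "y $ 0 \<in> (\<lambda>w. w $ 0) ` mat_image A"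
    unfolding mat_image_def image_image by (rule image_eqI)
qed

text \<open>\<open>invertible_mat\<close> leaves the size of the inverse implicit; it is recovered
  from the dimensions in the two product equations.\<close>

lemma invertible_mat_obtain:
  assumes "invertible_mat U" "U \<in> carrier_mat n m"
  obtains V where "n = m" "V \<in> carrier_mat n n" "U * V = 1\<^sub>m n" "V * U = 1\<^sub>m n"
proof -
  have dim: "dim_row U = n" "dim_col U = m" using assms(2) by auto
  have nm: "n = m"
    using assms(1) unfolding invertible_mat_def square_mat.simps dim by blast
  obtain V where UV: "U * V = 1\<^sub>m n" and VU: "V * U = 1\<^sub>m (dim_row V)"
    using assms(1) unfolding invertible_mat_def inverts_mat_def dim by blast
  have "dim_col V = n" "dim_row V = n"
    using arg_cong[OF UV, of dim_col] arg_cong[OF VU, of dim_col] by (simp_all add: dim nm)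
  then show ?thesis using that[OF nm _ UV] VU by auto
qed

text \<open>The first differentials differ by invertible factors on both sides. In degree 0 that
  factor is a unit, so the ideals are equal and not merely the cokernels isomorphic.\<close>

lemma complex_iso_H0:
  fixes X Y :: "nat \<Rightarrow> 'a::comm_ring_1 mat"
  assumes iso: "complex_iso X Y"
    and X: "X 0 \<in> carrier_mat 1 n" "rank X 1 = n" and Y: "Y 0 \<in> carrier_mat 1 n"
  shows "(\<lambda>w. w $ 0) ` mat_image (X 0) = (\<lambda>w. w $ 0) ` mat_image (Y 0)"
proof -
  obtain U where chain: "chain_map X Y U" and inv: "\<forall>k. invertible_mat (U k)"
    using iso unfolding complex_iso_def by (elim exE conjE)
  have U: "U k \<in> carrier_mat (rank Y k) (rank X k)" and comm: "U k * X k = Y k * U (Suc k)" for k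
    using chain[unfolded chain_map_def, rule_format, of k] by (rule conjunct1, rule conjunct2)
  note comm = comm[of 0, folded One_nat_def]
  have U0: "U 0 \<in> carrier_mat 1 1"
    using U[of 0] unfolding rank_def carrier_matD(1)[OF X(1)] carrier_matD(1)[OF Y] .
  obtain V where V: "V \<in> carrier_mat 1 1" "U 0 * V = 1\<^sub>m 1" "V * U 0 = 1\<^sub>m 1"
    by (rule invertible_mat_obtain[OF inv[rule_format] U0])
  have "rank Y 1 = n"
    using invertible_mat_obtain[OF inv[rule_format] U, of 1] unfolding X(2) by blast
  then have U1: "U 1 \<in> carrier_mat n n" using U[of 1] unfolding X(2) by (rule subst)
  obtain W where W: "W \<in> carrier_mat n n" "U 1 * W = 1\<^sub>m n" "W * U 1 = 1\<^sub>m n"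
    by (rule invertible_mat_obtain[OF inv[rule_format] U1])
  have "X 0 = V * U 0 * X 0" unfolding V(3) using X(1) by simp
  also have "\<dots> = V * (U 0 * X 0)" using V(1) U0 X(1) by (rule assoc_mult_mat)
  also have "\<dots> = V * Y 0 * U 1"
    unfolding comm using assoc_mult_mat[OF V(1) Y U1] by simp
  finally have X0: "X 0 = V * Y 0 * U 1" .
  have "Y 0 = Y 0 * (U 1 * W)" unfolding W(2) using Y by simp
  also have "\<dots> = Y 0 * U 1 * W" using assoc_mult_mat[OF Y U1 W(1)] by simp
  also have "\<dots> = U 0 * X 0 * W" using comm by simp
  finally have Y0: "Y 0 = U 0 * X 0 * W" .
  show ?thesis
    using row_image_mult_subset[OF V(1) Y U1] row_image_mult_subset[OF U0 X(1) W(1)]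
    unfolding X0[symmetric] Y0[symmetric] by blast
qed

lemma doubling_0_carrier:
  assumes "minimal_free_resolution [1, 5, 6, 2] I F"
  shows "doubling F \<psi> 0 \<in> carrier_mat 1 7"
proof -
  have rank: "rank F n = (if n < length [1::nat, 5, 6, 2] then [1, 5, 6, 2] ! n else 0)"
    and carrier: "F n \<in> carrier_mat (rank F n) (rank F (Suc n))" for n
    using assms unfolding minimal_free_resolution_def free_resolution_def free_complex_def by blast+
  have "F 0 \<in> carrier_mat 1 5" "F 2 \<in> carrier_mat 6 2"
    using carrier[of 0] carrier[of 2] rank by (simp_all add: numeral_eq_Suc)
  then show ?thesis
    by (intro carrier_matI)
      (simp_all add: doubling_def rank_def dual_complex_def extend_S_def base_change_def)
qed

theorem theorem7p2:
  fixes F :: "nat \<Rightarrow> 'k::field S mat"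
    and \<psi> :: "nat \<Rightarrow> 'k S_ext mat"
    and G :: "nat \<Rightarrow> 'k R_KM mat"
  assumes "CHAR('k) \<noteq> 2"
    and "minimal_free_resolution [1, 5, 6, 2] (ideal_gen J_gens) F"
    and "F 2 = d3"
    and "doubling_lift F \<psi>"
    and "minimal_free_resolution [1, 7, 12, 7, 1] I_KM G"
  shows "\<not> is_specialization G (doubling F \<psi>)"
proof
  assume "is_specialization G (doubling F \<psi>)"
  then obtain \<phi> :: "'k R_KM \<Rightarrow> 'k S_ext" where \<phi>: "comm_ring_hom \<phi>"
    and iso: "complex_iso (base_change \<phi> G) (doubling F \<psi>)"
    unfolding is_specialization_def by blast
  have rank: "rank G n = (if n < length [1::nat, 7, 12, 7, 1] then [1, 7, 12, 7, 1] ! n else 0)"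
    and carrier: "G n \<in> carrier_mat (rank G n) (rank G (Suc n))"
    and H0: "(\<lambda>w. w $ 0) ` mat_image (G 0) = I_KM" for n
    using assms(5)
    unfolding minimal_free_resolution_def free_resolution_def free_complex_def by blast+
  have G0: "G 0 \<in> carrier_mat 1 7" and G1: "rank G 1 = 7"
    using carrier[of 0] rank by simp_all
  \<comment> \<open>The specialization would present \<open>I_t\<close> as generated by the
    Kustin-Miller elements at the images of the variables.\<close>
  have "I_t = (\<lambda>w. w $ 0) ` mat_image (doubling F \<psi> 0)"
    by (rule doubling_H0[OF assms(2,4), symmetric])
  also have "\<dots> = (\<lambda>w. w $ 0) ` mat_image (base_change \<phi> G 0)"
    by (rule complex_iso_H0[OF iso, symmetric])
      (use G0 G1 doubling_0_carrier[OF assms(2)] in \<open>simp_all add: base_change_def rank_def\<close>)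
  also have "\<dots> = ideal_gen (\<phi> ` km_ideal_gen ` {..<7})"
    using H0 unfolding I_KM_eq by (rule base_change_H0[of \<phi> G, OF \<phi> G0])
  also have "\<phi> ` km_ideal_gen ` {..<7}
      = km_gen (\<lambda>j. \<phi> (Var (KX j))) (\<lambda>i j. \<phi> (Var (KA i j))) (\<phi> (Var KV)) ` {..<7}"
    unfolding image_image km_ideal_gen_def by (intro image_cong refl hom_km_gen[OF \<phi>]) simp
  finally show False
    using ideal_gen_km_gen_neq_I_t[OF assms(1)] by metis
qed

end
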